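(* Let $\mathcal{X}$ be a topological space equipped with its Borel $\sigma$-field, let $\mathcal{Y}$ be a measurable space, let $\mu$ be a probability measure on $\mathcal{X}$ and $\nu$ a probability measure on $\mathcal{Y}$, and let $p:\mathcal{X}\times\mathcal{Y}\to[0,\infty)$ be jointly measurable. Suppose that $p(x,y)>0$ for all $x\in\mathcal{X},y\in\mathcal{Y}$ and that $\sup_{x\in\mathcal{X},y\in\mathcal{Y}}p(x,y)<\infty$. Suppose moreover that there exists a nonempty compact set $K\subset\mathcal{X}$ such that: (a) for all $y\in\mathcal{Y}$, the function $p(\cdot,y):\mathcal{X}\to(0,\infty)$ is continuous on $K$; (b) there exist finitely many $x_j\in\mathcal{X}$ and $c_j>0$, $1\le j\le J$, such that $\sup_{x\in K}p(x,y)\le\sum_{j\le J}c_j\,p(x_j,y)$ for all $y\in\mathcal{Y}$. Then the Schrödinger system $$\mathsf{a}(dx)\int_{\mathcal{Y}}p(x,y)\,\mathsf{b}(dy)=\mu(dx),\qquad \mathsf{b}(dy)\int_{\mathcal{X}}p(x,y)\,\mathsf{a}(dx)=\nu(dy)$$ admits a unique solution $(\mathsf{a},\mathsf{b})$, uniqueness being understood up to the transformations $(\mathsf{a},\mathsf{b})\mapsto(\kappa^{-1}\mathsf{a},\kappa\mathsf{b})$, $\kappa>0$.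
   Context: A solution of the Schrödinger system is a pair $(\mathsf{a},\mathsf{b})$ where $\mathsf{a}$ is a $\sigma$-finite nonnegative measure on $\mathcal{X}$ and $\mathsf{b}$ is a $\sigma$-finite nonnegative measure on $\mathcal{Y}$ satisfying the two displayed identities between measures (on $\mathcal{X}$ and on $\mathcal{Y}$ respectively). *)

theory Defs
  imports "HOL-Probability.Probability"
begin

(* The measures on the two sides carry the measurable structure: X is the measurable space
   underlying mu, Y the one underlying nu. The inner integrals are extended nonnegative Lebesgue
   integrals, so they are allowed to be infinite a priori; a(dx) f(x) is rendered as density a f.
   The sigma-finiteness of a and b makes these densities measurable (Tonelli) whenever p is
   jointly measurable, so density never takes its junk value. *)
definition schroedinger_solution ::
  "'x measure \<Rightarrow> 'y measure \<Rightarrow> ('x \<Rightarrow> 'y \<Rightarrow> real) \<Rightarrow> 'x measure \<Rightarrow> 'y measure \<Rightarrow> bool" where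
  "schroedinger_solution \<mu> \<nu> p a b \<longleftrightarrow>
     sigma_finite_measure a \<and> sets a = sets \<mu> \<and>
     sigma_finite_measure b \<and> sets b = sets \<nu> \<and>
     density a (\<lambda>x. \<integral>\<^sup>+ y. ennreal (p x y) \<partial>b) = \<mu> \<and>
     density b (\<lambda>y. \<integral>\<^sup>+ x. ennreal (p x y) \<partial>a) = \<nu>"

end

(* A solution has the form a = f mu, b = g nu with f(x) g(y) p(x,y) the density of a coupling.

   Two such couplings (f,g), (f',g') are compared by integrating the bounded function
   T(x) + U(y), T = (f' - f)/(f' + f), U = (g' - g)/(g' + g), against the difference of the couplings.
   The result depends on the marginals only, while T + U = 2(f'g' - fg)/((f + f')(g + g')) has the sign of
   f'g' - fg.  Hence the integral of p (f'g' - fg)^2/((f + f')(g + g')) is controlled by the marginal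
   errors: exact marginals give uniqueness without any entropy or integrability condition, and
   almost exact marginals give a Cauchy estimate.

   Approximate solutions come from the regularised system f (e + int p g dnu) = 1 = g (e + int p f dmu),
   solved by monotone iteration.  Their marginal defect tends to 0 with e.  Scaled so that 1 is nearly
   a median of f, they are bounded pointwise along the sequence because p is positive and bounded;
   so f_n(x) g_n(y) converges almost everywhere, its limit is again a product, and tightness of the
   marginals excludes loss of mass. *)
theory Submission
  imports Defs
begin

text \<open>\<open>T\<close> and \<open>U\<close> are tanh of half of log (f'/f) and of half of log
  (g'/g). They replace the logarithms that an entropy argument would integrate against the
  difference of the couplings: tanh is odd and increasing, so the sum of two values has the sign of
  the sum of the arguments, but it is bounded, and the integrability of log f or log g never becomes
  an issue.

  The obstacle to existence is that p has no positive lower bound, so that the equations give no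
  uniform control of f and g. The substitute is that a positive function on a probability space is
  bounded below off a set of small probability. Hence its integral against a bounded weight of given
  mean has a positive lower bound, at each fixed point of the other space. The vanishing of the
  defect and the pointwise bounds both rest on this.

  In the limit the marginal conditions survive only as inequalities, by Fatou; the conservation of
  mass turns them back into equalities.\<close>

section \<open>Preliminaries on probability spaces, densities and real sequences\<close>

lemma (in prob_space) expectation_weighted_lower_bound:
  fixes q :: "'a \<Rightarrow> real"
  assumes [measurable]: "q \<in> borel_measurable M"
    and q: "\<And>x. 0 < q x" "\<And>x. q x \<le> S" and m: "0 < m"
  shows "\<exists>\<delta>>0. \<forall>k \<in> borel_measurable M. (\<forall>x. 0 \<le> k x \<and> k x \<le> C) \<longrightarrow> m \<le> expectation k
           \<longrightarrow> \<delta> \<le> expectation (\<lambda>x. q x * k x)"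
proof -
  \<comment> \<open>The sets where \<open>q\<close> is small shrink to the empty set, so one of them
    satisfies \<open>\<bar>C\<bar> * prob (E n) < m / 2\<close>. A weight bounded by
    \<open>C\<close> with mean at least \<open>m\<close> keeps half of \<open>m\<close> off that
    set, which makes \<delta> the same for all \<open>k\<close>. The absolute value is there because
    the sign of \<open>C\<close> is known only once some \<open>k\<close> is given.\<close>
  define E where "E n = {x \<in> space M. q x < inverse (real (Suc n))}" for n
  have E [measurable, simp]: "E n \<in> sets M" for n unfolding E_def by measurable
  have dec: "decseq E"
    unfolding E_def decseq_def
    by (auto intro: less_le_trans le_imp_inverse_le)
  have "(\<Inter>n. E n) = {}"
  proof (safe, simp)
    fix x assume *: "\<forall>n. x \<in> E n"
    obtain n where "inverse (real (Suc n)) < q x" using reals_Archimedean[OF q(1)] by blast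
    with * show False unfolding E_def by (smt (verit) mem_Collect_eq)
  qed
  then have "(\<lambda>n. prob (E n)) \<longlonglongrightarrow> 0"
    using finite_Lim_measure_decseq[OF _ dec] by (simp add: image_subset_iff)
  then have "(\<lambda>n. \<bar>C\<bar> * prob (E n)) \<longlonglongrightarrow> \<bar>C\<bar> * 0" by (intro tendsto_intros)
  then have "\<forall>\<^sub>F n in sequentially. \<bar>C\<bar> * prob (E n) < m / 2"
    using m by (intro order_tendstoD(2)) auto
  then obtain n where n: "\<bar>C\<bar> * prob (E n) < m / 2" by (auto simp: eventually_sequentially)
  define d where "d = inverse (real (Suc n))"
  have d: "0 < d" unfolding d_def by simp
  show ?thesis
  proof (intro exI[of _ "d * (m / 2)"] conjI ballI impI)
    show "0 < d * (m / 2)" using d m by simp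
    fix k assume [measurable]: "k \<in> borel_measurable M"
      and k: "\<forall>x. 0 \<le> k x \<and> k x \<le> C" and mk: "m \<le> expectation k"
    have C: "0 \<le> C" using k order_trans by blast
    have ik: "integrable M k"
      using k by (intro integrable_const_bound[of _ C]) auto
    have S: "0 \<le> S" using q[of undefined] by linarith
    have iqk: "integrable M (\<lambda>x. q x * k x)"
      using k q S C by (intro integrable_const_bound[of _ "S * C"]) (auto simp: abs_mult less_imp_le intro!: mult_mono)
    have "d * (m / 2) \<le> d * (expectation k - C * prob (E n))"
      using mk n C d by (intro mult_left_mono) auto
    also have "\<dots> = expectation (\<lambda>x. d * (k x - C * indicator (E n) x))"
    proof -
      have iE: "integrable M (\<lambda>x. C * indicator (E n) x)"
        by (intro integrable_mult_right integrable_real_indicator) (auto simp: less_top[symmetric])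
      show ?thesis
        by (simp only: integral_mult_right_zero Bochner_Integration.integral_diff[OF ik iE]) simp
    qed
    also have "\<dots> \<le> expectation (\<lambda>x. q x * k x)"
    proof (intro integral_mono iqk)
      show "integrable M (\<lambda>x. d * (k x - C * indicator (E n) x))"
        by (intro integrable_mult_right Bochner_Integration.integrable_diff integrable_real_indicator ik)
          (auto simp: less_top[symmetric])
      fix x assume x: "x \<in> space M"
      show "d * (k x - C * indicator (E n) x) \<le> q x * k x"
      proof (cases "x \<in> E n")
        case True
        then show ?thesis using k q d by (auto intro!: order_trans[of "d * (k x - C)" 0] mult_nonneg_nonpos simp: less_imp_le)
      next
        case False
        then have "d \<le> q x" using x by (auto simp: E_def d_def)
        then show ?thesis using False k by (auto intro!: mult_right_mono)
      qed
    qed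
    finally show "d * (m / 2) \<le> expectation (\<lambda>x. q x * k x)" .
  qed
qed

text \<open>Serves to pick generic points: with \<open>Q\<close> constantly false on a probability
  space it produces a point satisfying an almost sure property, and with another \<open>Q\<close> a
  point that in addition escapes \<open>Q\<close>.\<close>

lemma ex_of_not_AE:
  assumes "AE x in L. P x" "\<not> (AE x in L. Q x)"
  shows "\<exists>x\<in>space L. P x \<and> \<not> Q x"
proof (rule ccontr)
  assume "\<not> ?thesis"
  then have "AE x in L. P x \<longrightarrow> Q x" by (intro AE_I2) auto
  with assms(1) have "AE x in L. Q x" by eventually_elim auto
  with assms(2) show False by simp
qed

lemma discrepancy_identity:
  fixes a b c d :: real
  assumes "0 < a" "0 < b" "0 < c" "0 < d"
  shows "((b - a) / (a + b) + (d - c) / (c + d)) * (b * d - a * c)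
    = 2 * ((b * d - a * c)\<^sup>2 / ((a + b) * (c + d)))"
proof -
  have *: "a + b \<noteq> 0" "c + d \<noteq> 0" using assms by auto
  have "(b - a) / (a + b) + (d - c) / (c + d) = 2 * (b * d - a * c) / ((a + b) * (c + d))"
    using * by (simp add: add_frac_eq) (simp add: algebra_simps)
  then show ?thesis by (simp add: power2_eq_square)
qed

lemma convergent_of_summable_diff:
  fixes a :: "nat \<Rightarrow> real"
  assumes "summable (\<lambda>n. a (Suc n) - a n)"
  shows "convergent a"
proof -
  have "convergent (\<lambda>n. (\<Sum>i<n. a (Suc i) - a i) + a 0)"
    using assms by (intro convergent_add convergent_const) (simp add: summable_iff_convergent)
  then show ?thesis by (simp add: sum_lessThan_telescope)
qed

text \<open>The device that upgrades marginal inequalities to equalities: 1 - s is nonnegative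
  almost everywhere and has integral zero.\<close>

lemma (in prob_space) AE_eq_1_of_nn_integral:
  assumes [measurable]: "s \<in> borel_measurable M"
    and le: "AE x in M. s x \<le> 1" and ge: "1 \<le> (\<integral>\<^sup>+ x. s x \<partial>M)"
  shows "AE x in M. s x = 1"
proof -
  have le1: "(\<integral>\<^sup>+ x. s x \<partial>M) \<le> (\<integral>\<^sup>+ x. 1 \<partial>M)"
    by (rule nn_integral_mono_AE) (use le in auto)
  have "(\<integral>\<^sup>+ x. 1 - s x \<partial>M) = (\<integral>\<^sup>+ x. 1 \<partial>M) - (\<integral>\<^sup>+ x. s x \<partial>M)"
    using le1 le by (intro nn_integral_diff) (auto simp: emeasure_space_1 top_unique)
  also have "\<dots> = 0" using ge by (simp add: emeasure_space_1 diff_eq_0_iff_ennreal)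
  finally have "AE x in M. 1 - s x = 0" by (subst (asm) nn_integral_0_iff_AE) auto
  with le show ?thesis
    by eventually_elim (auto simp: diff_eq_0_iff_ennreal intro: antisym)
qed

text \<open>Bounds that depend on the point become uniform off a set of small probability, by
  continuity from above. This supplies the truncation sets used later.\<close>

lemma (in prob_space) prob_unbounded_tendsto_0:
  fixes u :: "nat \<Rightarrow> 'a \<Rightarrow> real"
  assumes [measurable]: "\<And>n. u n \<in> borel_measurable M"
    and u: "\<And>x. x \<in> space M \<Longrightarrow> \<exists>C. \<forall>n. u n x \<le> C"
  shows "(\<lambda>j. prob (space M - {x \<in> space M. \<forall>n. u n x \<le> real j})) \<longlonglongrightarrow> 0"
proof -
  define E where "E j = space M - {x \<in> space M. \<forall>n. u n x \<le> real j}" for j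
  have "E j \<in> sets M" for j unfolding E_def by measurable
  moreover have "decseq E" unfolding E_def decseq_def by (auto intro: order_trans)
  moreover have "(\<Inter>j. E j) = {}"
  proof (safe, simp)
    fix x assume x: "\<forall>j. x \<in> E j"
    then have "x \<in> space M" by (auto simp: E_def)
    then obtain C where "\<And>n. u n x \<le> C" using u by blast
    moreover obtain j where "C \<le> real j" using real_arch_simple by blast
    ultimately have "x \<notin> E j" using \<open>x \<in> space M\<close> by (auto simp: E_def intro: order_trans)
    with x show False by blast
  qed
  ultimately have "(\<lambda>j. prob (E j)) \<longlonglongrightarrow> 0"
    using finite_Lim_measure_decseq[of E] by (simp add: image_subset_iff)
  then show ?thesis by (simp only: E_def)
qed

text \<open>Any \<kappa> in \<open>A\<close> above half of its supremum works, since then 2\<kappa>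
  lies outside \<open>A\<close>. The factor 2 leaves room, so whether the supremum is attained need
  not be settled.\<close>

lemma (in prob_space) near_median:
  fixes f :: "'a \<Rightarrow> real"
  assumes [measurable]: "f \<in> borel_measurable M"
    and f: "\<And>x. 0 < f x" "\<And>x. f x \<le> C"
  shows "\<exists>\<kappa>>0. 1/2 \<le> prob {x \<in> space M. \<kappa> \<le> f x} \<and> 1/2 \<le> prob {x \<in> space M. f x < 2 * \<kappa>}"
proof -
  define A where "A = {t. 0 < t \<and> 1/2 \<le> prob {x \<in> space M. t \<le> f x}}"
  define E where "E n = {x \<in> space M. inverse (real (Suc n)) \<le> f x}" for n
  have [measurable]: "E n \<in> sets M" for n unfolding E_def by measurable
  have "incseq E"
    unfolding E_def incseq_def
    by (auto intro: order_trans[rotated] le_imp_inverse_le)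
  moreover have "(\<Union>n. E n) = space M"
  proof (safe; simp)
    fix x assume "x \<in> space M"
    obtain n where "inverse (real (Suc n)) < f x" using reals_Archimedean[OF f(1)] by blast
    with \<open>x \<in> space M\<close> have "x \<in> E n" unfolding E_def by (simp add: less_imp_le)
    then show "\<exists>n. x \<in> E n" by blast
  qed (auto simp: E_def)
  ultimately have "(\<lambda>n. prob (E n)) \<longlonglongrightarrow> 1"
    using finite_Lim_measure_incseq[of E] by (simp add: prob_space image_subset_iff)
  then have "\<forall>\<^sub>F n in sequentially. 1/2 < prob (E n)"
    by (intro order_tendstoD(1)) auto
  then obtain n where "1/2 < prob (E n)" by (auto simp: eventually_sequentially)
  then have ne: "inverse (real (Suc n)) \<in> A" unfolding A_def E_def by simp
  have bdd: "t \<le> C" if "t \<in> A" for t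
  proof (rule ccontr)
    assume "\<not> t \<le> C"
    then have "{x \<in> space M. t \<le> f x} = {}" using f(2) by (auto simp: not_le intro: le_less_trans)
    moreover have "1/2 \<le> prob {x \<in> space M. t \<le> f x}" using that by (simp add: A_def)
    ultimately show False by (simp only: measure_empty)
  qed
  then have bA: "bdd_above A" using bdd by (auto intro: bdd_aboveI[of _ C])
  have "0 < Sup A"
    using cSup_upper[OF ne bA] by (rule less_le_trans[rotated]) simp
  then have "Sup A / 2 < Sup A" by simp
  then obtain \<kappa> where \<kappa>: "\<kappa> \<in> A" "Sup A / 2 < \<kappa>"
    using less_cSup_iff[OF _ bA] ne by blast
  have "2 * \<kappa> \<notin> A" using cSup_upper[OF _ bA, of "2 * \<kappa>"] \<kappa>(2) by auto
  then have "prob {x \<in> space M. 2 * \<kappa> \<le> f x} < 1/2" using \<kappa> by (auto simp: A_def)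
  moreover have "prob {x \<in> space M. f x < 2 * \<kappa>} = 1 - prob {x \<in> space M. 2 * \<kappa> \<le> f x}"
    by (subst prob_compl[symmetric]) (auto intro!: arg_cong[of _ _ prob])
  ultimately show ?thesis using \<kappa> by (auto simp: A_def)
qed

lemma density_cmult_eq_scale_measure:
  assumes [measurable]: "f \<in> borel_measurable M"
  shows "density M (\<lambda>x. c * f x) = scale_measure c (density M f)"
  by (rule measure_eqI) (auto simp: emeasure_density nn_integral_cmult mult.assoc)

lemma density_cong_space:
  assumes "\<And>x. x \<in> space M \<Longrightarrow> u x = v x"
  shows "density M u = density M v"
  unfolding density_def
  by (rule measure_of_eq[OF sets.space_closed]) (intro nn_integral_cong, simp add: assms)

subsection \<open>The regularised system\<close>

text \<open>The bounds on the kernel hold at all points of the types, which avoids membership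
  conditions; a kernel controlled on the spaces alone is extended by a constant beforehand.\<close>

locale bounded_positive_kernel = pair_prob_space M N
  for M :: "'x measure" and N :: "'y measure" +
  fixes p :: "'x \<Rightarrow> 'y \<Rightarrow> real" and S :: real
  assumes measurable_kernel: "(\<lambda>(x, y). p x y) \<in> borel_measurable (M \<Otimes>\<^sub>M N)"
    and kernel_pos: "0 < p x y" and kernel_le: "p x y \<le> S"
begin

lemma kernel_measurable [measurable (raw)]:
  assumes "u \<in> measurable L M" "v \<in> measurable L N"
  shows "(\<lambda>z. p (u z) (v z)) \<in> borel_measurable L"
  using measurable_compose[OF measurable_Pair[OF assms] measurable_kernel] by simp

lemma bound_pos: "0 < S"
  using kernel_pos[of undefined undefined] kernel_le[of undefined undefined] by linarith

text \<open>The setting is symmetric, so each statement about rows yields its counterpart about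
  columns by this interpretation.\<close>

lemma flip: "bounded_positive_kernel N M (\<lambda>y x. p x y) S"
proof -
  interpret flip: pair_prob_space N M ..
  show ?thesis
    by unfold_locales (auto simp: kernel_pos kernel_le)
qed

lemma integrable_kernel_mult:
  assumes [measurable]: "g \<in> borel_measurable N" and g: "\<And>y. 0 \<le> g y" "\<And>y. g y \<le> C" and x: "x \<in> space M"
  shows "integrable N (\<lambda>y. p x y * g y)"
proof (rule M2.integrable_const_bound[of _ "S * C"])
  show "(\<lambda>y. p x y * g y) \<in> borel_measurable N" using x by measurable
  have "0 \<le> C" using g order_trans by blast
  then show "AE y in N. norm (p x y * g y) \<le> S * C"
    using g kernel_pos kernel_le bound_pos by (intro AE_I2) (auto simp: abs_mult less_imp_le intro!: mult_mono)
qed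

text \<open>Each half step \<open>F\<close>, \<open>G\<close> reverses the order, so their
  composition is monotone. Started at 0 it produces increasing iterates, capped by
  \<open>1 / \<epsilon>\<close> because the denominators are at least \<epsilon>. The same cap is
  the dominating constant that lets the limit pass through both integrals.\<close>

lemma regularized_system:
  assumes \<epsilon>: "0 < \<epsilon>"
  shows "\<exists>f \<in> borel_measurable M. \<exists>g \<in> borel_measurable N.
    (\<forall>x. 0 < f x \<and> f x \<le> 1 / \<epsilon>) \<and> (\<forall>y. 0 < g y \<and> g y \<le> 1 / \<epsilon>) \<and>
    (\<forall>x\<in>space M. f x * (\<epsilon> + (\<integral>y. p x y * g y \<partial>N)) = 1) \<and>
    (\<forall>y\<in>space N. g y * (\<epsilon> + (\<integral>x. p x y * f x \<partial>M)) = 1)"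
proof -
  interpret flip: bounded_positive_kernel N M "\<lambda>y x. p x y" S by (rule flip)
  define G where "G u y = 1 / (\<epsilon> + (\<integral>x. p x y * u x \<partial>M))" for u y
  define F where "F v x = 1 / (\<epsilon> + (\<integral>y. p x y * v y \<partial>N))" for v x
  have G_bounds: "0 < G u y \<and> G u y \<le> 1 / \<epsilon>" if "\<And>x. 0 \<le> u x" for u y
  proof -
    have "0 \<le> (\<integral>x. p x y * u x \<partial>M)" using that kernel_pos by (intro integral_nonneg_AE AE_I2) (auto simp: less_imp_le)
    then show ?thesis using \<epsilon> by (auto simp: G_def intro!: divide_left_mono add_pos_nonneg)
  qed
  have F_bounds: "0 < F v x \<and> F v x \<le> 1 / \<epsilon>" if "\<And>y. 0 \<le> v y" for v x
  proof -
    have "0 \<le> (\<integral>y. p x y * v y \<partial>N)" using that kernel_pos by (intro integral_nonneg_AE AE_I2) (auto simp: less_imp_le)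
    then show ?thesis using \<epsilon> by (auto simp: F_def intro!: divide_left_mono add_pos_nonneg)
  qed
  have [measurable]: "G u \<in> borel_measurable N" if [measurable]: "u \<in> borel_measurable M" for u
    unfolding G_def by measurable
  have [measurable]: "F v \<in> borel_measurable M" if [measurable]: "v \<in> borel_measurable N" for v
    unfolding F_def by measurable
  define u where "u n = ((\<lambda>w. F (G w)) ^^ n) (\<lambda>_. 0)" for n
  have u_Suc: "u (Suc n) = F (G (u n))" and u_0: "u 0 = (\<lambda>_. 0)" for n by (auto simp: u_def)
  have u_meas [measurable]: "u n \<in> borel_measurable M" for n
    by (induction n) (auto simp: u_Suc u_0)
  have u_bounds: "0 \<le> u n x \<and> u n x \<le> 1 / \<epsilon>" for n x
  proof (induction n arbitrary: x)
    case 0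
    then show ?case using \<epsilon> by (simp add: u_0)
  next
    case (Suc n)
    have "0 \<le> G (u n) y" for y using G_bounds[of "u n" y] Suc by (auto simp: less_imp_le)
    then show ?case using F_bounds[of "G (u n)" x] by (auto simp: u_Suc)
  qed
  have Gu: "0 < G (u n) y" "0 \<le> G (u n) y" "G (u n) y \<le> 1 / \<epsilon>" for n y
    using G_bounds[of "u n" y] u_bounds by auto
  have mono: "u n x \<le> u (Suc n) x" if "x \<in> space M" for n x
    using that
  proof (induction n arbitrary: x)
    case 0
    show ?case using u_bounds by (simp add: u_0 del: funpow.simps)
  next
    case (Suc n)
    have "G (u (Suc n)) y \<le> G (u n) y" if y: "y \<in> space N" for y
      unfolding G_def using \<epsilon> y u_bounds Suc.IH kernel_pos
      by (intro divide_left_mono add_left_mono integral_mono mult_pos_pos add_pos_nonneg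
            integral_nonneg_AE AE_I2 flip.integrable_kernel_mult[where C="1 / \<epsilon>"] mult_left_mono)
        (auto simp: less_imp_le)
    then have "F (G (u n)) x \<le> F (G (u (Suc n))) x"
      unfolding F_def using \<epsilon> Suc.prems Gu kernel_pos
      by (intro divide_left_mono add_left_mono integral_mono mult_pos_pos add_pos_nonneg
            integral_nonneg_AE AE_I2 integrable_kernel_mult[where C="1 / \<epsilon>"] mult_left_mono)
        (auto simp: less_imp_le)
    then show ?case by (simp add: u_Suc)
  qed
  define f0 where "f0 x = lim (\<lambda>n. u n x)" for x
  have [measurable]: "f0 \<in> borel_measurable M" unfolding f0_def by measurable
  have conv: "(\<lambda>n. u n x) \<longlonglongrightarrow> f0 x" if "x \<in> space M" for x
  proof -
    have "convergent (\<lambda>n. u n x)"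
      using mono[OF that] u_bounds
      by (intro Bseq_mono_convergent BseqI'[of _ "1 / \<epsilon>"]) (auto intro: lift_Suc_mono_le)
    then show ?thesis unfolding f0_def by (simp add: convergent_LIMSEQ_iff)
  qed
  have f0_nonneg: "0 \<le> f0 x" if "x \<in> space M" for x
    using LIMSEQ_le_const[OF conv[OF that]] u_bounds by blast
  have conv_G: "(\<lambda>n. G (u n) y) \<longlonglongrightarrow> G f0 y" if y: "y \<in> space N" for y
  proof -
    have "(\<lambda>n. \<integral>x. p x y * u n x \<partial>M) \<longlonglongrightarrow> (\<integral>x. p x y * f0 x \<partial>M)"
    proof (rule integral_dominated_convergence[where w="\<lambda>_. S * (1 / \<epsilon>)"])
      show "AE x in M. (\<lambda>n. p x y * u n x) \<longlonglongrightarrow> p x y * f0 x"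
        using conv by (intro AE_I2 tendsto_intros)
      show "AE x in M. norm (p x y * u n x) \<le> S * (1 / \<epsilon>)" for n
        using u_bounds[of n] kernel_le kernel_pos bound_pos unfolding norm_mult
        by (intro AE_I2 mult_mono) (auto simp: less_imp_le)
    qed (use y in measurable)
    moreover have "0 \<le> (\<integral>x. p x y * f0 x \<partial>M)"
      using f0_nonneg kernel_pos
      by (intro integral_nonneg_AE AE_I2 mult_nonneg_nonneg) (auto simp: less_imp_le)
    ultimately show ?thesis unfolding G_def using \<epsilon> by (intro tendsto_intros) auto
  qed
  have Gf0: "0 < G f0 y \<and> G f0 y \<le> 1 / \<epsilon>" if y: "y \<in> space N" for y
  proof -
    have "0 \<le> (\<integral>x. p x y * f0 x \<partial>M)"
      using f0_nonneg kernel_pos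
      by (intro integral_nonneg_AE AE_I2 mult_nonneg_nonneg) (auto simp: less_imp_le)
    then show ?thesis using \<epsilon> by (auto simp: G_def intro!: divide_left_mono add_pos_nonneg)
  qed
  have int_Gf0: "0 \<le> (\<integral>y. p x y * G f0 y \<partial>N)" for x
    using Gf0 kernel_pos by (intro integral_nonneg_AE AE_I2 mult_nonneg_nonneg) (auto simp: less_imp_le)
  have fixpt: "f0 x = F (G f0) x" if x: "x \<in> space M" for x
  proof (rule LIMSEQ_unique)
    show "(\<lambda>n. u (Suc n) x) \<longlonglongrightarrow> f0 x" using conv[OF x] by (rule LIMSEQ_Suc)
    have "(\<lambda>n. \<integral>y. p x y * G (u n) y \<partial>N) \<longlonglongrightarrow> (\<integral>y. p x y * G f0 y \<partial>N)"
    proof (rule integral_dominated_convergence[where w="\<lambda>_. S * (1 / \<epsilon>)"])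
      show "AE y in N. (\<lambda>n. p x y * G (u n) y) \<longlonglongrightarrow> p x y * G f0 y"
        using conv_G by (intro AE_I2 tendsto_intros)
      show "AE y in N. norm (p x y * G (u n) y) \<le> S * (1 / \<epsilon>)" for n
        using Gu[of n] kernel_le kernel_pos bound_pos unfolding norm_mult
        by (intro AE_I2 mult_mono) (auto simp: less_imp_le)
    qed (use x in measurable)
    then show "(\<lambda>n. u (Suc n) x) \<longlonglongrightarrow> F (G f0) x"
      unfolding u_Suc F_def[of _ x] using \<epsilon> int_Gf0[of x] by (intro tendsto_intros) auto
  qed
  \<comment> \<open>\<open>f0\<close> is controlled on \<open>space M\<close> only.
    \<open>F (G f0)\<close> agrees with it there and satisfies the bounds at every point;
    \<open>g\<close> receives an admissible value off \<open>space N\<close> for the same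
    purpose.\<close>
  define f where "f = F (G f0)"
  define g where "g = (\<lambda>y. if y \<in> space N then G f0 y else 1 / \<epsilon>)"
  have "(\<integral>x. p x y * f x \<partial>M) = (\<integral>x. p x y * f0 x \<partial>M)" for y
    by (rule Bochner_Integration.integral_cong) (auto simp: fixpt f_def)
  then have gf: "g y = 1 / (\<epsilon> + (\<integral>x. p x y * f x \<partial>M))" if "y \<in> space N" for y
    using that by (simp add: g_def G_def)
  have "(\<integral>y. p x y * g y \<partial>N) = (\<integral>y. p x y * G f0 y \<partial>N)" for x
    by (rule Bochner_Integration.integral_cong) (auto simp: g_def)
  then have fg: "f x = 1 / (\<epsilon> + (\<integral>y. p x y * g y \<partial>N))" for x
    by (simp add: f_def F_def)
  have g: "0 < g y \<and> g y \<le> 1 / \<epsilon>" for y using Gf0 \<epsilon> by (auto simp: g_def)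
  have f: "0 < f x \<and> f x \<le> 1 / \<epsilon>" for x
    using int_Gf0[of x] \<epsilon> unfolding f_def F_def by (auto intro!: divide_left_mono add_pos_nonneg)
  show ?thesis
  proof (intro bexI[of _ f] bexI[of _ g] conjI allI ballI)
    show "f x * (\<epsilon> + (\<integral>y. p x y * g y \<partial>N)) = 1" for x
      using fg[of x] f[of x] by (auto simp: field_simps)
    show "g y * (\<epsilon> + (\<integral>x. p x y * f x \<partial>M)) = 1" if "y \<in> space N" for y
      using gf[OF that] g[of y] by (auto simp: field_simps)
    show "f \<in> borel_measurable M" unfolding f_def by measurable
    have "G f0 \<in> borel_measurable N" by measurable
    then show "g \<in> borel_measurable N"
      by (rule measurable_cong[THEN iffD1, rotated]) (auto simp: g_def)
  qed (use f g in auto)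
qed

subsection \<open>Comparing two couplings\<close>

text \<open>The measure with density \<open>p x y * (f x * g y)\<close> has marginals dominated by
  \<open>M\<close> and \<open>N\<close> and misses at most \<eta> of the mass. Both marginals carry
  the same total mass, so the single number \<eta> bounds the L1 defect on either side; \<eta> = 0
  means exact marginals.\<close>

definition subcoupling :: "real \<Rightarrow> ('x \<Rightarrow> real) \<Rightarrow> ('y \<Rightarrow> real) \<Rightarrow> bool" where
  "subcoupling \<eta> f g \<longleftrightarrow>
     f \<in> borel_measurable M \<and> g \<in> borel_measurable N \<and> (\<forall>x. 0 < f x) \<and> (\<forall>y. 0 < g y) \<and>
     integrable (M \<Otimes>\<^sub>M N) (\<lambda>(x, y). p x y * (f x * g y)) \<and>
     (AE x in M. f x * (\<integral>y. p x y * g y \<partial>N) \<le> 1) \<and>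
     (AE y in N. g y * (\<integral>x. p x y * f x \<partial>M) \<le> 1) \<and>
     1 - \<eta> \<le> (\<integral>(x, y). p x y * (f x * g y) \<partial>(M \<Otimes>\<^sub>M N))"

lemma subcoupling_flip:
  assumes "subcoupling \<eta> f g"
  shows "bounded_positive_kernel.subcoupling N M (\<lambda>y x. p x y) \<eta> g f"
proof -
  interpret flip: bounded_positive_kernel N M "\<lambda>y x. p x y" S by (rule flip)
  have int: "integrable (M \<Otimes>\<^sub>M N) (\<lambda>(x, y). p x y * (f x * g y))"
    using assms by (simp add: subcoupling_def)
  have "integrable (N \<Otimes>\<^sub>M M) (\<lambda>(y, x). p x y * (g y * f x))"
    using integrable_product_swap[OF int] by (simp add: mult.commute)
  moreover have "(\<integral>(y, x). p x y * (g y * f x) \<partial>(N \<Otimes>\<^sub>M M)) = (\<integral>(x, y). p x y * (f x * g y) \<partial>(M \<Otimes>\<^sub>M N))"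
    using integral_product_swap[OF borel_measurable_integrable[OF int]] by (simp add: mult.commute)
  ultimately show ?thesis
    using assms unfolding flip.subcoupling_def by (auto simp: subcoupling_def)
qed

text \<open>By Fubini a weight depending on \<open>x\<close> alone sees the coupling only through
  the density of its first marginal,
  \<open>f x * (\<integral>y. p x y * g y \<partial>N)\<close>.\<close>

lemma integral_row_weight:
  assumes int: "integrable (M \<Otimes>\<^sub>M N) (\<lambda>(x, y). p x y * (f x * g y))"
    and [measurable]: "T \<in> borel_measurable M" and T: "\<And>x. \<bar>T x\<bar> \<le> 1"
  shows "integrable (M \<Otimes>\<^sub>M N) (\<lambda>(x, y). T x * (p x y * (f x * g y)))"
    and "integrable M (\<lambda>x. T x * (f x * (\<integral>y. p x y * g y \<partial>N)))"
    and "(\<integral>(x, y). T x * (p x y * (f x * g y)) \<partial>(M \<Otimes>\<^sub>M N)) = (\<integral>x. T x * (f x * (\<integral>y. p x y * g y \<partial>N)) \<partial>M)"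
proof -
  have [measurable]: "(\<lambda>(x, y). p x y * (f x * g y)) \<in> borel_measurable (M \<Otimes>\<^sub>M N)"
    using int by (rule borel_measurable_integrable)
  have "(\<lambda>z. T (fst z) * (case z of (x, y) \<Rightarrow> p x y * (f x * g y))) \<in> borel_measurable (M \<Otimes>\<^sub>M N)"
    by measurable
  then show i: "integrable (M \<Otimes>\<^sub>M N) (\<lambda>(x, y). T x * (p x y * (f x * g y)))"
    using T by (intro Bochner_Integration.integrable_bound[OF int])
      (auto simp: split_beta' abs_mult intro!: mult_left_le_one_le)
  have eq: "(\<integral>y. T x * (p x y * (f x * g y)) \<partial>N) = T x * (f x * (\<integral>y. p x y * g y \<partial>N))" for x
  proof -
    have "(\<lambda>y. T x * (p x y * (f x * g y))) = (\<lambda>y. (T x * f x) * (p x y * g y))"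
      by (simp add: algebra_simps)
    then show ?thesis by (simp only: integral_mult_right_zero mult.assoc)
  qed
  show "integrable M (\<lambda>x. T x * (f x * (\<integral>y. p x y * g y \<partial>N)))"
    using integrable_fst[OF i] by (simp only: eq)
  show "(\<integral>(x, y). T x * (p x y * (f x * g y)) \<partial>(M \<Otimes>\<^sub>M N)) = (\<integral>x. T x * (f x * (\<integral>y. p x y * g y \<partial>N)) \<partial>M)"
    using integral_fst[OF i] by (simp only: eq)
qed

text \<open>Only the first marginals \<open>s\<close> and \<open>s'\<close> enter. Both lie below 1,
  so \<bar>s' - s\<bar> is at most (1 - s) + (1 - s'), and the integral of the latter is at most the
  sum of the two mass defects.\<close>

lemma integral_weighted_difference_le:
  assumes sub: "subcoupling \<eta> f g" "subcoupling \<eta>' f' g'"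
    and [measurable]: "T \<in> borel_measurable M" and T: "\<And>x. \<bar>T x\<bar> \<le> 1"
  shows "integrable (M \<Otimes>\<^sub>M N) (\<lambda>(x, y). T x * (p x y * (f' x * g' y - f x * g y)))"
    and "(\<integral>(x, y). T x * (p x y * (f' x * g' y - f x * g y)) \<partial>(M \<Otimes>\<^sub>M N)) \<le> \<eta> + \<eta>'"
proof -
  have int: "integrable (M \<Otimes>\<^sub>M N) (\<lambda>(x, y). p x y * (f x * g y))"
    "integrable (M \<Otimes>\<^sub>M N) (\<lambda>(x, y). p x y * (f' x * g' y))"
    using sub by (auto simp: subcoupling_def)
  define s where "s x = f x * (\<integral>y. p x y * g y \<partial>N)" for x
  define s' where "s' x = f' x * (\<integral>y. p x y * g' y \<partial>N)" for x
  note W = integral_row_weight[OF int(1) assms(3) T, folded s_def]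
    integral_row_weight[OF int(2) assms(3) T, folded s'_def]
  note O = integral_row_weight[OF int(1), of "\<lambda>_. 1", simplified, folded s_def]
    integral_row_weight[OF int(2), of "\<lambda>_. 1", simplified, folded s'_def]
  have eq: "(\<lambda>(x, y). T x * (p x y * (f' x * g' y - f x * g y))) =
      (\<lambda>z. (case z of (x, y) \<Rightarrow> T x * (p x y * (f' x * g' y))) - (case z of (x, y) \<Rightarrow> T x * (p x y * (f x * g y))))"
    by (auto simp: fun_eq_iff algebra_simps)
  show "integrable (M \<Otimes>\<^sub>M N) (\<lambda>(x, y). T x * (p x y * (f' x * g' y - f x * g y)))"
    unfolding eq by (intro Bochner_Integration.integrable_diff W)
  have "(\<integral>(x, y). T x * (p x y * (f' x * g' y - f x * g y)) \<partial>(M \<Otimes>\<^sub>M N)) =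
      (\<integral>x. T x * s' x \<partial>M) - (\<integral>x. T x * s x \<partial>M)"
    unfolding eq by (subst Bochner_Integration.integral_diff) (use W in auto)
  also have "\<dots> = (\<integral>x. T x * s' x - T x * s x \<partial>M)"
    by (rule Bochner_Integration.integral_diff[symmetric]) (use W in auto)
  also have "\<dots> \<le> (\<integral>x. 2 - s x - s' x \<partial>M)"
  proof (rule integral_mono_AE)
    have "AE x in M. s x \<le> 1" "AE x in M. s' x \<le> 1"
      using sub by (auto simp: subcoupling_def s_def s'_def)
    then show "AE x in M. T x * s' x - T x * s x \<le> 2 - s x - s' x"
    proof eventually_elim
      fix x assume s: "s x \<le> 1" "s' x \<le> 1"
      have "T x * (s' x - s x) \<le> \<bar>T x\<bar> * \<bar>s' x - s x\<bar>" by (simp flip: abs_mult)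
      also have "\<dots> \<le> 1 * \<bar>s' x - s x\<bar>" using T by (intro mult_right_mono) auto
      finally show "T x * s' x - T x * s x \<le> 2 - s x - s' x" using s by (simp add: algebra_simps)
    qed
  qed (use W O in auto)
  also have "\<dots> = 2 - (\<integral>x. s x \<partial>M) - (\<integral>x. s' x \<partial>M)"
    using O by (simp add: M1.prob_space)
  also have "\<dots> \<le> \<eta> + \<eta>'"
    using sub O by (simp add: subcoupling_def)
  finally show "(\<integral>(x, y). T x * (p x y * (f' x * g' y - f x * g y)) \<partial>(M \<Otimes>\<^sub>M N)) \<le> \<eta> + \<eta>'" .
qed

text \<open>A weakened triangular discrimination of the densities \<open>f x * g y\<close> and
  \<open>f' x * g' y\<close>: the denominator expands to their sum plus the cross terms. The cross
  terms are what lets it factor into a part in \<open>x\<close> and a part in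
  \<open>y\<close>.\<close>

definition discrepancy :: "('x \<Rightarrow> real) \<Rightarrow> ('y \<Rightarrow> real) \<Rightarrow> ('x \<Rightarrow> real) \<Rightarrow> ('y \<Rightarrow> real) \<Rightarrow> 'x \<Rightarrow> 'y \<Rightarrow> real" where
  "discrepancy f g f' g' x y =
     p x y * ((f' x * g' y - f x * g y)\<^sup>2 / ((f x + f' x) * (g y + g' y)))"

text \<open>\<open>T\<close> is controlled by the first marginals and \<open>U\<close>, through the
  flipped kernel, by the second, each at a cost of \<eta> + \<eta>'. The factor 2 in
  \<open>discrepancy_identity\<close> absorbs the two contributions.\<close>

lemma discrepancy_le:
  assumes sub: "subcoupling \<eta> f g" "subcoupling \<eta>' f' g'"
  shows "integrable (M \<Otimes>\<^sub>M N) (\<lambda>(x, y). discrepancy f g f' g' x y)"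
    and "(\<integral>(x, y). discrepancy f g f' g' x y \<partial>(M \<Otimes>\<^sub>M N)) \<le> \<eta> + \<eta>'"
proof -
  interpret flip: bounded_positive_kernel N M "\<lambda>y x. p x y" S by (rule flip)
  have [measurable]: "f \<in> borel_measurable M" "f' \<in> borel_measurable M"
    "g \<in> borel_measurable N" "g' \<in> borel_measurable N"
    and pos: "\<And>x. 0 < f x" "\<And>x. 0 < f' x" "\<And>y. 0 < g y" "\<And>y. 0 < g' y"
    using sub by (auto simp: subcoupling_def)
  define T where "T x = (f' x - f x) / (f x + f' x)" for x
  define U where "U y = (g' y - g y) / (g y + g' y)" for y
  have [measurable]: "T \<in> borel_measurable M" "U \<in> borel_measurable N"
    unfolding T_def U_def by measurable
  have T: "\<bar>T x\<bar> \<le> 1" for x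
    using pos(1,2)[of x] by (auto simp: T_def abs_div_pos[symmetric] abs_le_iff divide_le_eq_1 minus_divide_left)
  have U: "\<bar>U y\<bar> \<le> 1" for y
    using pos(3,4)[of y] by (auto simp: U_def abs_div_pos[symmetric] abs_le_iff divide_le_eq_1 minus_divide_left)
  note IT = integral_weighted_difference_le[where T=T, OF sub _ T, simplified]
  note IU' = flip.integral_weighted_difference_le[where T=U, OF subcoupling_flip[OF sub(1)] subcoupling_flip[OF sub(2)] _ U, simplified]
  have IU: "integrable (M \<Otimes>\<^sub>M N) (\<lambda>(x, y). U y * (p x y * (f' x * g' y - f x * g y)))"
    using flip.integrable_product_swap[OF IU'(1)] by (simp add: mult.commute)
  have "(\<integral>(x, y). U y * (p x y * (f' x * g' y - f x * g y)) \<partial>(M \<Otimes>\<^sub>M N)) \<le> \<eta> + \<eta>'"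
    using flip.integral_product_swap[OF borel_measurable_integrable[OF IU'(1)]] IU'(2)
    by (simp add: mult.commute)
  note IU = IU this
  have eq: "(\<lambda>(x, y). discrepancy f g f' g' x y) = (\<lambda>z. (1/2) *
      ((case z of (x, y) \<Rightarrow> T x * (p x y * (f' x * g' y - f x * g y)))
      + (case z of (x, y) \<Rightarrow> U y * (p x y * (f' x * g' y - f x * g y)))))"
  proof -
    have "2 * discrepancy f g f' g' x y = T x * (p x y * (f' x * g' y - f x * g y)) + U y * (p x y * (f' x * g' y - f x * g y))" for x y
      using discrepancy_identity[OF pos(1)[of x] pos(2)[of x] pos(3)[of y] pos(4)[of y]]
      unfolding discrepancy_def T_def U_def by (metis (no_types, opaque_lifting) distrib_right mult.left_commute)
    from this[symmetric] show ?thesis by (auto simp: fun_eq_iff)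
  qed
  show "integrable (M \<Otimes>\<^sub>M N) (\<lambda>(x, y). discrepancy f g f' g' x y)"
    unfolding eq using IT(1) IU(1) by (intro integrable_mult_right Bochner_Integration.integrable_add)
  show "(\<integral>(x, y). discrepancy f g f' g' x y \<partial>(M \<Otimes>\<^sub>M N)) \<le> \<eta> + \<eta>'"
    unfolding eq using IT IU
    by (simp only: integral_mult_right_zero Bochner_Integration.integral_add) simp
qed

subsection \<open>Approximate solutions\<close>

lemma integrable_bounded_coupling:
  assumes [measurable]: "f \<in> borel_measurable M" "g \<in> borel_measurable N"
    and f: "\<And>x. 0 \<le> f x" "\<And>x. f x \<le> C" and g: "\<And>y. 0 \<le> g y" "\<And>y. g y \<le> C'"
  shows "integrable (M \<Otimes>\<^sub>M N) (\<lambda>(x, y). p x y * (f x * g y))"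
proof (rule P.integrable_const_bound[of _ "S * (C * C')"])
  have "0 \<le> C" "0 \<le> C'" using f g order_trans by blast+
  then have "\<bar>p x y\<bar> * (\<bar>f x\<bar> * \<bar>g y\<bar>) \<le> S * (C * C')" for x y
    using f[of x] g[of y] kernel_pos[of x y] kernel_le[of x y] by (intro mult_mono) auto
  then show "AE z in M \<Otimes>\<^sub>M N. norm (case z of (x, y) \<Rightarrow> p x y * (f x * g y)) \<le> S * (C * C')"
    by (auto simp: abs_mult)
qed measurable

text \<open>The regularising term is exactly the row defect:
  \<open>f x * (\<integral>y. p x y * g y \<partial>N)\<close> equals
  \<open>1 - \<epsilon> * f x\<close>. The flipped version computes the same mass from
  \<open>g\<close>, so that \<epsilon>f and \<epsilon>g have equal means.\<close>

lemma regularized_system_mass: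
  assumes \<epsilon>: "0 < \<epsilon>"
    and [measurable]: "f \<in> borel_measurable M" "g \<in> borel_measurable N"
    and f: "\<And>x. 0 < f x" "\<And>x. f x \<le> 1 / \<epsilon>"
    and g: "\<And>y. 0 < g y" "\<And>y. g y \<le> 1 / \<epsilon>"
    and fg: "\<And>x. x \<in> space M \<Longrightarrow> f x * (\<epsilon> + (\<integral>y. p x y * g y \<partial>N)) = 1"
  shows "(\<integral>(x, y). p x y * (f x * g y) \<partial>(M \<Otimes>\<^sub>M N)) = 1 - (\<integral>x. \<epsilon> * f x \<partial>M)"
proof -
  have int: "integrable (M \<Otimes>\<^sub>M N) (\<lambda>(x, y). p x y * (f x * g y))"
    using f g by (intro integrable_bounded_coupling[where C="1/\<epsilon>" and C'="1/\<epsilon>"]) (auto simp: less_imp_le)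
  have intf: "integrable M f"
    using f by (intro M1.integrable_const_bound[of _ "1 / \<epsilon>"]) (auto simp: less_imp_le)
  have "(\<integral>(x, y). p x y * (f x * g y) \<partial>(M \<Otimes>\<^sub>M N)) = (\<integral>x. f x * (\<integral>y. p x y * g y \<partial>N) \<partial>M)"
    using integral_row_weight(3)[OF int, of "\<lambda>_. 1"] by simp
  also have "\<dots> = (\<integral>x. 1 - \<epsilon> * f x \<partial>M)"
    by (rule Bochner_Integration.integral_cong) (use fg in \<open>auto simp: algebra_simps\<close>)
  also have "\<dots> = 1 - (\<integral>x. \<epsilon> * f x \<partial>M)"
    using intf by (simp add: M1.prob_space)
  finally show ?thesis .
qed

text \<open>The point is that the common defect \<open>m n\<close> of rows and columns vanishes. If
  the mean of \<open>e n * f n\<close> is not small, positivity of p makes the integral of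
  \<open>p x y * f n x\<close> of order at least 1 / \<open>e n\<close>, so the column equation
  forces \<open>g n y\<close> to be of order at most \<open>e n\<close>; but then the mean of
  \<open>e n * g n\<close>, which is \<open>m n\<close> again, is small. Multiplying f and g by
  reciprocal constants leaves the coupling unchanged, which makes room for the median
  condition.\<close>

lemma approximate_system:
  assumes \<eta>: "0 < \<eta>"
  shows "\<exists>f g. subcoupling \<eta> f g \<and> (\<exists>C. \<forall>x. f x \<le> C) \<and> (\<exists>C. \<forall>y. g y \<le> C) \<and>
    1/2 \<le> M1.prob {x \<in> space M. 1 \<le> f x} \<and> 1/2 \<le> M1.prob {x \<in> space M. f x < 2} \<and>
    (\<forall>x \<in> space M. f x * (\<integral>y. p x y * g y \<partial>N) \<le> 1) \<and>
    (\<forall>y \<in> space N. g y * (\<integral>x. p x y * f x \<partial>M) \<le> 1)"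
proof -
  interpret flip: bounded_positive_kernel N M "\<lambda>y x. p x y" S by (rule flip)
  define e where "e n = inverse (real (Suc n))" for n
  have e: "0 < e n" "e n \<le> 1" for n by (auto simp: e_def inverse_le_1_iff)
  have e_lim: "e \<longlonglongrightarrow> 0" unfolding e_def by (rule LIMSEQ_inverse_real_of_nat)
  define good where "good n f g \<longleftrightarrow> f \<in> borel_measurable M \<and> g \<in> borel_measurable N \<and>
    (\<forall>x. 0 < f x \<and> f x \<le> 1 / e n) \<and> (\<forall>y. 0 < g y \<and> g y \<le> 1 / e n) \<and>
    (\<forall>x\<in>space M. f x * (e n + (\<integral>y. p x y * g y \<partial>N)) = 1) \<and>
    (\<forall>y\<in>space N. g y * (e n + (\<integral>x. p x y * f x \<partial>M)) = 1)" for n f g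
  have "\<exists>f g. good n f g" for n
    using regularized_system[OF e(1)] unfolding good_def by blast
  then obtain f g where "\<And>n. good n (f n) (g n)" by metis
  note fg = this[unfolded good_def]
  have [measurable]: "f n \<in> borel_measurable M" "g n \<in> borel_measurable N" for n using fg by auto
  have f: "0 < f n x" "f n x \<le> 1 / e n" for n x using fg by auto
  have g: "0 < g n y" "g n y \<le> 1 / e n" for n y using fg by auto
  have row: "f n x * (e n + (\<integral>y. p x y * g n y \<partial>N)) = 1" if "x \<in> space M" for n x using fg that by auto
  have col: "g n y * (e n + (\<integral>x. p x y * f n x \<partial>M)) = 1" if "y \<in> space N" for n y using fg that by auto
  have ef: "0 \<le> e n * f n x" "e n * f n x \<le> 1" for n x
    using f[of n x] e[of n] by (auto simp: less_imp_le field_simps)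
  have eg: "0 \<le> e n * g n y" "e n * g n y \<le> 1" for n y
    using g[of n y] e[of n] by (auto simp: less_imp_le field_simps)
  have int: "integrable (M \<Otimes>\<^sub>M N) (\<lambda>(x, y). p x y * (f n x * g n y))" for n
    using f g by (intro integrable_bounded_coupling[where C="1/e n" and C'="1/e n"]) (auto simp: less_imp_le)
  define m where "m n = (\<integral>x. e n * f n x \<partial>M)" for n
  have mass: "(\<integral>(x, y). p x y * (f n x * g n y) \<partial>(M \<Otimes>\<^sub>M N)) = 1 - m n" for n
    unfolding m_def by (rule regularized_system_mass) (use e f g row in auto)
  have "(\<integral>(y, x). p x y * (g n y * f n x) \<partial>(N \<Otimes>\<^sub>M M)) = 1 - (\<integral>y. e n * g n y \<partial>N)" for n
    by (rule flip.regularized_system_mass) (use e f g col in auto)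
  moreover have "(\<integral>(y, x). p x y * (g n y * f n x) \<partial>(N \<Otimes>\<^sub>M M)) =
      (\<integral>(x, y). p x y * (f n x * g n y) \<partial>(M \<Otimes>\<^sub>M N))" for n
    using integral_product_swap[OF borel_measurable_integrable[OF int[of n]]] by (simp add: mult.commute)
  ultimately have m': "m n = (\<integral>y. e n * g n y \<partial>N)" for n using mass[of n] by simp
  have m: "0 \<le> m n" "m n \<le> 1" for n
  proof -
    show "0 \<le> m n" unfolding m_def using ef by (intro integral_nonneg_AE AE_I2)
    have "m n \<le> (\<integral>x. 1 \<partial>M)" unfolding m_def
      using ef by (intro integral_mono M1.integrable_const_bound[of _ 1]) auto
    then show "m n \<le> 1" by (simp add: M1.prob_space)
  qed
  have mg: "0 \<le> m n * (e n * g n y)" "m n * (e n * g n y) \<le> 1" for n y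
    using m[of n] eg[of n y] by (auto intro!: mult_nonneg_nonneg mult_le_one simp del: mult_eq_0_iff zero_le_mult_iff)
  \<comment> \<open>The extra factor \<open>m n\<close> replaces a passage to subsequences: either
    it is small itself, and \<open>e n * g n y\<close> is at most 1, or it is bounded below, and the
    lower bound for \<open>p\<close> makes \<open>g n y\<close> small.\<close>
  have pointwise: "(\<lambda>n. m n * (e n * g n y)) \<longlonglongrightarrow> 0" if y: "y \<in> space N" for y
  proof (rule LIMSEQ_I)
    fix r :: real assume r: "0 < r"
    have "(\<lambda>x. p x y) \<in> borel_measurable M" using y by measurable
    from M1.expectation_weighted_lower_bound[where C=1, OF this kernel_pos kernel_le half_gt_zero[OF r]]
    obtain \<delta> where \<delta>: "0 < \<delta>" and lower: "\<And>k. k \<in> borel_measurable M \<Longrightarrow> (\<forall>x. 0 \<le> k x \<and> k x \<le> 1)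
        \<Longrightarrow> r / 2 \<le> M1.expectation k \<Longrightarrow> \<delta> \<le> (\<integral>x. p x y * k x \<partial>M)" by blast
    have "\<forall>\<^sub>F n in sequentially. e n < \<delta> * (r / 2)"
      using e_lim \<delta> r by (intro order_tendstoD(2)) auto
    then obtain n0 where n0: "\<And>n. n \<ge> n0 \<Longrightarrow> e n < \<delta> * (r / 2)"
      by (auto simp: eventually_sequentially)
    have "m n * (e n * g n y) < r" if n: "n \<ge> n0" for n
    proof (cases "r / 2 \<le> m n")
      case True
      have "\<delta> \<le> (\<integral>x. p x y * (e n * f n x) \<partial>M)"
        using ef True by (intro lower) (auto simp: m_def)
      also have "\<dots> = e n * (\<integral>x. p x y * f n x \<partial>M)"
        by (simp add: mult.left_commute)
      finally have "g n y * \<delta> \<le> e n * (g n y * (\<integral>x. p x y * f n x \<partial>M))"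
        using g(1)[of n y] by (simp add: mult.left_commute)
      also have "\<dots> \<le> e n * 1"
        using col[OF y, of n] eg(1)[of n y] e(1)[of n] by (intro mult_left_mono) (auto simp: algebra_simps)
      also have "\<dots> < \<delta> * (r / 2)" using n0[OF n] by simp
      finally have "g n y < r / 2" using \<delta> by (simp add: mult.commute)
      moreover have "m n * (e n * g n y) \<le> 1 * (1 * g n y)"
        using m[of n] e[of n] g[of n y] by (intro mult_mono) (auto simp: less_imp_le)
      ultimately show ?thesis using r by simp
    next
      case False
      have "m n * (e n * g n y) \<le> m n * 1"
        using m[of n] eg[of n y] by (intro mult_left_mono)
      then show ?thesis using False r by simp
    qed
    then show "\<exists>n0. \<forall>n\<ge>n0. norm (m n * (e n * g n y) - 0) < r"
      using mg by (intro exI[of _ n0] allI impI) (simp only: real_norm_def diff_0_right abs_of_nonneg)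
  qed
  have "(\<lambda>n. \<integral>y. m n * (e n * g n y) \<partial>N) \<longlonglongrightarrow> (\<integral>y. 0 \<partial>N)"
  proof (rule integral_dominated_convergence[where w="\<lambda>_. 1"])
    show "AE y in N. norm (m n * (e n * g n y)) \<le> 1" for n
      using mg by (intro AE_I2) (simp only: real_norm_def abs_of_nonneg)
  qed (use pointwise in auto)
  \<comment> \<open>By \<open>m'\<close> the integral of \<open>e n * g n y\<close> is once more
    \<open>m n\<close>, so the integrated product is a square.\<close>
  then have "(\<lambda>n. m n * m n) \<longlonglongrightarrow> 0" by (simp add: m')
  then have "m \<longlonglongrightarrow> 0"
    using tendsto_real_sqrt[of "\<lambda>n. m n * m n" 0] m by (simp add: real_sqrt_mult_self abs_of_nonneg)
  then have "\<forall>\<^sub>F n in sequentially. m n < \<eta>"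
    using \<eta> by (intro order_tendstoD(2)) auto
  then obtain n where n: "m n < \<eta>" by (auto simp: eventually_sequentially)
  obtain \<kappa> where \<kappa>: "0 < \<kappa>" "1/2 \<le> M1.prob {x \<in> space M. \<kappa> \<le> f n x}"
      "1/2 \<le> M1.prob {x \<in> space M. f n x < 2 * \<kappa>}"
    using M1.near_median[of "f n" "1 / e n"] f by auto
  have row': "f n x / \<kappa> * (\<integral>y. p x y * (\<kappa> * g n y) \<partial>N) \<le> 1" if "x \<in> space M" for x
  proof -
    have "(\<integral>y. p x y * (\<kappa> * g n y) \<partial>N) = \<kappa> * (\<integral>y. p x y * g n y \<partial>N)"
      by (simp add: mult.left_commute)
    then have "f n x / \<kappa> * (\<integral>y. p x y * (\<kappa> * g n y) \<partial>N) = 1 - e n * f n x"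
      using row[OF that, of n] \<kappa>(1) by (simp add: algebra_simps)
    then show ?thesis using ef by simp
  qed
  have col': "(\<kappa> * g n y) * (\<integral>x. p x y * (f n x / \<kappa>) \<partial>M) \<le> 1" if "y \<in> space N" for y
  proof -
    have "(\<integral>x. p x y * (f n x / \<kappa>) \<partial>M) = (\<integral>x. p x y * f n x \<partial>M) / \<kappa>"
      by simp
    then have "(\<kappa> * g n y) * (\<integral>x. p x y * (f n x / \<kappa>) \<partial>M) = 1 - e n * g n y"
      using col[OF that, of n] \<kappa>(1) by (simp add: algebra_simps)
    then show ?thesis using eg by simp
  qed
  have scale: "p x y * (f n x / \<kappa> * (\<kappa> * g n y)) = p x y * (f n x * g n y)" for x y
    using \<kappa>(1) by simp
  show ?thesis
  proof (intro exI[of _ "\<lambda>x. f n x / \<kappa>"] exI[of _ "\<lambda>y. \<kappa> * g n y"] conjI)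
    show "subcoupling \<eta> (\<lambda>x. f n x / \<kappa>) (\<lambda>y. \<kappa> * g n y)"
      unfolding subcoupling_def scale mass
      using row' col' int n f g \<kappa>(1) by auto
    show "\<exists>C. \<forall>x. f n x / \<kappa> \<le> C"
      using f \<kappa>(1) by (intro exI[of _ "1 / e n / \<kappa>"]) (intro allI divide_right_mono, auto)
    show "\<exists>C. \<forall>y. \<kappa> * g n y \<le> C"
      using g \<kappa>(1) by (intro exI[of _ "\<kappa> * (1 / e n)"]) (intro allI mult_left_mono, auto)
  qed (use row' col' \<kappa> in \<open>auto simp: pos_le_divide_eq pos_divide_less_eq\<close>)
qed

section \<open>Tightness and pointwise bounds for normalised sequences\<close>

text \<open>The complement of A \<times> B is covered by two strips, and domination of the marginals
  bounds the mass of each strip by the probability of its base. The bound does not depend on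
  \<open>f\<close> and \<open>g\<close>, so it is uniform along a sequence of subcouplings.\<close>

lemma integral_coupling_restrict:
  assumes sub: "subcoupling \<eta> f g" and [measurable]: "A \<in> sets M" "B \<in> sets N"
  shows "integrable (M \<Otimes>\<^sub>M N) (\<lambda>(x, y). indicator A x * indicator B y * (p x y * (f x * g y)))"
    and "1 - \<eta> \<le> (\<integral>(x, y). indicator A x * indicator B y * (p x y * (f x * g y)) \<partial>(M \<Otimes>\<^sub>M N))
      + M1.prob (space M - A) + M2.prob (space N - B)"
proof -
  interpret flip: bounded_positive_kernel N M "\<lambda>y x. p x y" S by (rule flip)
  have int: "integrable (M \<Otimes>\<^sub>M N) (\<lambda>(x, y). p x y * (f x * g y))"
    using sub by (auto simp: subcoupling_def)
  have int': "integrable (N \<Otimes>\<^sub>M M) (\<lambda>(y, x). p x y * (g y * f x))"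
    using subcoupling_flip[OF sub] by (auto simp: flip.subcoupling_def)
  have pos: "0 < f x" "0 < g y" for x y using sub by (auto simp: subcoupling_def)
  have [measurable]: "f \<in> borel_measurable M" "g \<in> borel_measurable N"
    using sub by (auto simp: subcoupling_def)
  show iAB: "integrable (M \<Otimes>\<^sub>M N) (\<lambda>(x, y). indicator A x * indicator B y * (p x y * (f x * g y)))"
    by (rule Bochner_Integration.integrable_bound[OF int])
      (auto simp: abs_mult split: split_indicator)
  have ind: "\<bar>indicator D x :: real\<bar> \<le> 1" "\<bar>indicator E y :: real\<bar> \<le> 1" for D E and x :: 'x and y :: 'y
    by (auto split: split_indicator)
  have meas: "indicator (space M - A) \<in> borel_measurable M" "indicator (space N - B) \<in> borel_measurable N"
    by measurable
  note R = integral_row_weight[OF int meas(1) ind(1)]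
  note Q = flip.integral_row_weight[OF int' meas(2) ind(2)]
  have R_le: "(\<integral>(x, y). indicator (space M - A) x * (p x y * (f x * g y)) \<partial>(M \<Otimes>\<^sub>M N)) \<le> M1.prob (space M - A)"
  proof -
    have "(\<integral>x. indicator (space M - A) x * (f x * (\<integral>y. p x y * g y \<partial>N)) \<partial>M) \<le> (\<integral>x. indicator (space M - A) x \<partial>M)"
      using sub R(2)
      by (intro integral_mono_AE) (auto simp: subcoupling_def less_top[symmetric] split: split_indicator)
    then show ?thesis using R(3) by simp
  qed
  have Q_le: "(\<integral>(y, x). indicator (space N - B) y * (p x y * (g y * f x)) \<partial>(N \<Otimes>\<^sub>M M)) \<le> M2.prob (space N - B)"
  proof -
    have "(\<integral>y. indicator (space N - B) y * (g y * (\<integral>x. p x y * f x \<partial>M)) \<partial>N) \<le> (\<integral>y. indicator (space N - B) y \<partial>N)"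
      using sub Q(2)
      by (intro integral_mono_AE) (auto simp: subcoupling_def less_top[symmetric] split: split_indicator)
    then show ?thesis using Q(3) by simp
  qed
  have iR: "integrable (M \<Otimes>\<^sub>M N) (\<lambda>(x, y). indicator (space M - A) x * (p x y * (f x * g y)))"
    using R(1) by simp
  have iQ': "integrable (N \<Otimes>\<^sub>M M) (\<lambda>(y, x). indicator (space N - B) y * (p x y * (g y * f x)))"
    using Q(1) by simp
  have iQ: "integrable (M \<Otimes>\<^sub>M N) (\<lambda>(x, y). indicator (space N - B) y * (p x y * (f x * g y)))"
    using flip.integrable_product_swap[OF iQ'] by (simp add: mult.commute)
  have Q_eq: "(\<integral>(x, y). indicator (space N - B) y * (p x y * (f x * g y)) \<partial>(M \<Otimes>\<^sub>M N)) =
      (\<integral>(y, x). indicator (space N - B) y * (p x y * (g y * f x)) \<partial>(N \<Otimes>\<^sub>M M))"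
    using flip.integral_product_swap[OF borel_measurable_integrable[OF iQ']] by (simp add: mult.commute)
  have "1 - \<eta> \<le> (\<integral>(x, y). p x y * (f x * g y) \<partial>(M \<Otimes>\<^sub>M N))"
    using sub by (auto simp: subcoupling_def)
  also have "\<dots> \<le> (\<integral>z. (case z of (x, y) \<Rightarrow> indicator A x * indicator B y * (p x y * (f x * g y)))
      + ((case z of (x, y) \<Rightarrow> indicator (space M - A) x * (p x y * (f x * g y)))
      + (case z of (x, y) \<Rightarrow> indicator (space N - B) y * (p x y * (f x * g y)))) \<partial>(M \<Otimes>\<^sub>M N))"
    using int iAB iR iQ pos kernel_pos
    by (intro integral_mono Bochner_Integration.integrable_add)
      (auto simp: space_pair_measure less_imp_le split: split_indicator)
  also have "\<dots> = (\<integral>(x, y). indicator A x * indicator B y * (p x y * (f x * g y)) \<partial>(M \<Otimes>\<^sub>M N))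
      + ((\<integral>(x, y). indicator (space M - A) x * (p x y * (f x * g y)) \<partial>(M \<Otimes>\<^sub>M N))
      + (\<integral>(x, y). indicator (space N - B) y * (p x y * (f x * g y)) \<partial>(M \<Otimes>\<^sub>M N)))"
    by (simp only: Bochner_Integration.integral_add iAB iR iQ Bochner_Integration.integrable_add)
  finally show "1 - \<eta> \<le> (\<integral>(x, y). indicator A x * indicator B y * (p x y * (f x * g y)) \<partial>(M \<Otimes>\<^sub>M N))
      + M1.prob (space M - A) + M2.prob (space N - B)"
    using R_le Q_le Q_eq by linarith
qed

text \<open>The constraint gives \<open>h n\<close> at most the reciprocal of the integral of
  \<open>p x y * f n x\<close>, so that integral has to stay away from 0. The functions
  \<open>f n\<close> are bounded for each \<open>n\<close> but not uniformly, hence the minorants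
  \<open>k n\<close>: they have a common bound and a common lower bound on the mean, which is what
  the weighted lower bound requires.\<close>

lemma bounded_of_mass_lower_bound:
  fixes h :: "nat \<Rightarrow> real" and f k :: "nat \<Rightarrow> 'x \<Rightarrow> real"
  assumes y: "y \<in> space N" and m: "0 < m"
    and [measurable]: "\<And>n. f n \<in> borel_measurable M" "\<And>n. k n \<in> borel_measurable M"
    and f: "\<And>n x. 0 \<le> f n x" "\<And>n. \<exists>C. \<forall>x. f n x \<le> C"
    and k: "\<And>n x. 0 \<le> k n x" "\<And>n x. k n x \<le> c" "\<And>n x. k n x \<le> f n x" "\<And>n. m \<le> (\<integral>x. k n x \<partial>M)"
    and h: "\<And>n. 0 < h n" "\<And>n. h n * (\<integral>x. p x y * f n x \<partial>M) \<le> 1"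
  shows "\<exists>C. \<forall>n. h n \<le> C"
proof -
  interpret flip: bounded_positive_kernel N M "\<lambda>y x. p x y" S by (rule flip)
  have "(\<lambda>x. p x y) \<in> borel_measurable M" using y by measurable
  from M1.expectation_weighted_lower_bound[where C=c, OF this kernel_pos kernel_le m]
  obtain \<delta> where \<delta>: "0 < \<delta>" and lower: "\<And>k. k \<in> borel_measurable M \<Longrightarrow> (\<forall>x. 0 \<le> k x \<and> k x \<le> c)
        \<Longrightarrow> m \<le> M1.expectation k \<Longrightarrow> \<delta> \<le> (\<integral>x. p x y * k x \<partial>M)" by blast
  have "h n \<le> 1 / \<delta>" for n
  proof -
    obtain C where C: "\<And>x. f n x \<le> C" using f(2) by blast
    have "\<delta> \<le> (\<integral>x. p x y * k n x \<partial>M)" using k by (intro lower) auto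
    also have "\<dots> \<le> (\<integral>x. p x y * f n x \<partial>M)"
      using y k(1,2,3) f(1) C kernel_pos
      by (intro integral_mono flip.integrable_kernel_mult[where C=c] flip.integrable_kernel_mult[where C=C] mult_left_mono)
        (auto simp: less_imp_le)
    finally have "h n * \<delta> \<le> h n * (\<integral>x. p x y * f n x \<partial>M)"
      using h(1)[of n] by (intro mult_left_mono) (auto simp: less_imp_le)
    with h(2)[of n] have "h n * \<delta> \<le> 1" by (rule order_trans[rotated])
    then show ?thesis using \<delta> by (simp add: field_simps)
  qed
  then show ?thesis by blast
qed

text \<open>Each half of the median condition serves one side. Where \<open>f n\<close> is at least
  1, its indicator is a minorant of mean 1/2, which bounds \<open>g n\<close>. Where
  \<open>f n\<close> is below 2, tightness prevents the coupling from having little mass there, so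
  \<open>g n\<close> truncated to \<open>B j\<close> keeps a definite mean, which bounds
  \<open>f n\<close>.\<close>

lemma normalized_sequence_bounded:
  fixes f :: "nat \<Rightarrow> 'x \<Rightarrow> real" and g :: "nat \<Rightarrow> 'y \<Rightarrow> real"
  assumes sub: "\<And>n. subcoupling (\<eta> n) (f n) (g n)" and \<eta>: "\<And>n. \<eta> n \<le> 1/8"
    and bdd: "\<And>n. \<exists>C. \<forall>x. f n x \<le> C" "\<And>n. \<exists>C. \<forall>y. g n y \<le> C"
    and median: "\<And>n. 1/2 \<le> M1.prob {x \<in> space M. 1 \<le> f n x}" "\<And>n. 1/2 \<le> M1.prob {x \<in> space M. f n x < 2}"
    and row: "\<And>n x. x \<in> space M \<Longrightarrow> f n x * (\<integral>y. p x y * g n y \<partial>N) \<le> 1"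
    and col: "\<And>n y. y \<in> space N \<Longrightarrow> g n y * (\<integral>x. p x y * f n x \<partial>M) \<le> 1"
  shows "\<And>y. y \<in> space N \<Longrightarrow> \<exists>C. \<forall>n. g n y \<le> C"
    and "\<And>x. x \<in> space M \<Longrightarrow> \<exists>C. \<forall>n. f n x \<le> C"
proof -
  interpret flip: bounded_positive_kernel N M "\<lambda>y x. p x y" S by (rule flip)
  have [measurable]: "f n \<in> borel_measurable M" "g n \<in> borel_measurable N"
    and pos: "0 < f n x" "0 < g n y" for n x y
    using sub by (auto simp: subcoupling_def)
  show g_bdd: "\<exists>C. \<forall>n. g n y \<le> C" if y: "y \<in> space N" for y
  proof (rule bounded_of_mass_lower_bound[where f=f and k="\<lambda>n. indicator {x \<in> space M. 1 \<le> f n x}" and c=1 and m="1/2"])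
    show "indicator {x \<in> space M. 1 \<le> f n x} x \<le> f n x" for n x
      using pos(1)[of n x] by (auto split: split_indicator)
    show "1/2 \<le> (\<integral>x. (indicator {x \<in> space M. 1 \<le> f n x} x :: real) \<partial>M)" for n
      using median(1)[of n] by (simp add: Int_absorb2 subset_eq)
  qed (use y pos bdd col in \<open>auto simp: less_imp_le indicator_le_1\<close>)
  define B where "B j = {y \<in> space N. \<forall>n. g n y \<le> real j}" for j
  have [measurable]: "B j \<in> sets N" for j unfolding B_def by measurable
  have "(\<lambda>j. M2.prob (space N - B j)) \<longlonglongrightarrow> 0"
    unfolding B_def using g_bdd by (intro M2.prob_unbounded_tendsto_0) auto
  then have "\<forall>\<^sub>F j in sequentially. M2.prob (space N - B j) < 1/8"
    by (intro order_tendstoD(2)) auto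
  then obtain j where j: "M2.prob (space N - B j) < 1/8" by (auto simp: eventually_sequentially)
  show "\<exists>C. \<forall>n. f n x \<le> C" if x: "x \<in> space M" for x
  proof (rule flip.bounded_of_mass_lower_bound[where f=g and k="\<lambda>n y. indicator (B j) y * g n y" and c="real j" and m="1 / (8 * S)"])
    show "indicator (B j) y * g n y \<le> real j" for n y by (auto simp: B_def split: split_indicator)
    show "indicator (B j) y * g n y \<le> g n y" for n y using pos(2)[of n y] by (auto split: split_indicator)
    show "1 / (8 * S) \<le> (\<integral>y. indicator (B j) y * g n y \<partial>N)" for n
    proof -
      define A where "A = {x \<in> space M. f n x < 2}"
      have [measurable]: "A \<in> sets M" unfolding A_def by measurable
      have ig: "integrable (M \<Otimes>\<^sub>M N) (\<lambda>(x, y). 2 * S * (indicator (B j) y * g n y))"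
      proof (rule P.integrable_const_bound[of _ "2 * S * real j"])
        show "AE z in M \<Otimes>\<^sub>M N. norm (case z of (x, y) \<Rightarrow> 2 * S * (indicator (B j) y * g n y)) \<le> 2 * S * real j"
          using bound_pos pos by (auto simp: abs_mult B_def less_imp_le split: split_indicator)
      qed measurable
      have "M1.prob (space M - A) \<le> 1/2"
        using median(2)[of n] by (simp add: M1.prob_compl A_def[symmetric])
      \<comment> \<open>1/4 = 1 - 1/8 - 1/2 - 1/8: the defect and the probabilities of the two
        complements are removed. On the remaining rectangle p is at most \<open>S\<close> and
        \<open>f n\<close> at most 2, which explains the minorant mean
        \<open>1 / (8 * S)\<close>.\<close>
      then have "1/4 \<le> (\<integral>(x, y). indicator A x * indicator (B j) y * (p x y * (f n x * g n y)) \<partial>(M \<Otimes>\<^sub>M N))"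
        using integral_coupling_restrict(2)[OF sub[of n], of A "B j"] \<eta>[of n] j by simp
      also have "\<dots> \<le> (\<integral>(x, y). 2 * S * (indicator (B j) y * g n y) \<partial>(M \<Otimes>\<^sub>M N))"
      proof (intro integral_mono ig integral_coupling_restrict(1)[OF sub])
        fix z assume "z \<in> space (M \<Otimes>\<^sub>M N)"
        have "p x y * (f n x * g n y) \<le> 2 * S * g n y" if "x \<in> A" for x y
        proof -
          have "p x y * f n x \<le> S * 2"
            using that kernel_le[of x y] kernel_pos[of x y] pos(1)[of n x] bound_pos
            by (intro mult_mono) (auto simp: A_def less_imp_le)
          from mult_right_mono[OF this less_imp_le[OF pos(2)]] show ?thesis by (simp add: mult_ac)
        qed
        then show "(case z of (x, y) \<Rightarrow> indicator A x * indicator (B j) y * (p x y * (f n x * g n y)))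
            \<le> (case z of (x, y) \<Rightarrow> 2 * S * (indicator (B j) y * g n y))"
          using pos(2)[of n] bound_pos by (cases z) (auto simp: less_imp_le split: split_indicator)
      qed measurable
      also have "\<dots> = 2 * S * (\<integral>y. indicator (B j) y * g n y \<partial>N)"
        using integral_fst[OF ig] by (simp add: M1.prob_space)
      finally show ?thesis using bound_pos by (simp add: field_simps)
    qed
    show "0 < 1 / (8 * S)" using bound_pos by simp
  qed (use x pos bdd row in \<open>auto simp: less_imp_le\<close>)
qed

lemma discrepancy_nonneg:
  assumes "0 < f x" "0 < f' x" "0 < g y" "0 < g' y"
  shows "0 \<le> discrepancy f g f' g' x y"
  using assms kernel_pos[of x y] by (auto simp: discrepancy_def less_imp_le)

subsection \<open>Passage to the limit\<close>

text \<open>The defects decay like 8^-n so that the discrepancies stay summable after multiplication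
  by 4^n. Almost everywhere this bounds 4^n times the discrepancy, and since the discrepancy is
  quadratic in the increment of the product, the increments are bounded by a multiple of
  2^-n.\<close>

lemma AE_convergent_of_discrepancy:
  fixes f :: "nat \<Rightarrow> 'x \<Rightarrow> real" and g :: "nat \<Rightarrow> 'y \<Rightarrow> real"
  assumes sub: "\<And>n. subcoupling ((1/8) ^ Suc n) (f n) (g n)"
    and f: "\<And>x. x \<in> space M \<Longrightarrow> \<exists>C. \<forall>n. f n x \<le> C"
    and g: "\<And>y. y \<in> space N \<Longrightarrow> \<exists>C. \<forall>n. g n y \<le> C"
  shows "AE z in M \<Otimes>\<^sub>M N. convergent (\<lambda>n. f n (fst z) * g n (snd z))"
proof -
  have pos: "0 < f n x" "0 < g n y" for n x y
    using sub by (auto simp: subcoupling_def)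
  define D where "D n x y = discrepancy (f n) (g n) (f (Suc n)) (g (Suc n)) x y" for n x y
  have D_nonneg: "0 \<le> D n x y" for n x y
    unfolding D_def using pos by (intro discrepancy_nonneg)
  note D_int = discrepancy_le[OF sub sub, of n "Suc n" for n, folded D_def]
  have [measurable]: "(\<lambda>z. D n (fst z) (snd z)) \<in> borel_measurable (M \<Otimes>\<^sub>M N)" for n
    using borel_measurable_integrable[OF D_int(1)] by (simp add: split_beta')
  have D_le: "(\<integral>\<^sup>+ z. ennreal (4 ^ n * D n (fst z) (snd z)) \<partial>(M \<Otimes>\<^sub>M N)) \<le> ennreal ((1/2) ^ n)" for n
  proof -
    have "(\<integral>\<^sup>+ z. ennreal (4 ^ n * D n (fst z) (snd z)) \<partial>(M \<Otimes>\<^sub>M N)) =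
        ennreal (\<integral>z. 4 ^ n * D n (fst z) (snd z) \<partial>(M \<Otimes>\<^sub>M N))"
      using D_int(1) D_nonneg by (intro nn_integral_eq_integral integrable_mult_right) (auto simp: split_beta')
    also have "\<dots> \<le> ennreal ((1/2) ^ n)"
    proof (rule ennreal_leI)
      have "(\<integral>z. 4 ^ n * D n (fst z) (snd z) \<partial>(M \<Otimes>\<^sub>M N)) \<le> 4 ^ n * ((1/8) ^ Suc n + (1/8) ^ Suc (Suc n))"
        using D_int(2)[of n] by (simp add: split_beta')
      also have "\<dots> = (9/64) * (4 ^ n * (1/8) ^ n)" by (simp add: algebra_simps)
      also have "4 ^ n * (1/8) ^ n = (1/2 :: real) ^ n" by (simp flip: power_mult_distrib)
      finally show "(\<integral>z. 4 ^ n * D n (fst z) (snd z) \<partial>(M \<Otimes>\<^sub>M N)) \<le> (1/2) ^ n"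
        by (rule order_trans) simp
    qed
    finally show ?thesis .
  qed
  have "(\<integral>\<^sup>+ z. (\<Sum>n. ennreal (4 ^ n * D n (fst z) (snd z))) \<partial>(M \<Otimes>\<^sub>M N)) =
      (\<Sum>n. \<integral>\<^sup>+ z. ennreal (4 ^ n * D n (fst z) (snd z)) \<partial>(M \<Otimes>\<^sub>M N))"
    by (intro nn_integral_suminf) measurable
  also have "\<dots> \<le> (\<Sum>n. ennreal ((1/2) ^ n))"
    by (intro suminf_le D_le) auto
  also have "\<dots> = ennreal (\<Sum>n. (1/2) ^ n)"
    by (intro suminf_ennreal2 summable_geometric) auto
  also have "\<dots> < \<infinity>" by simp
  finally have "AE z in M \<Otimes>\<^sub>M N. (\<Sum>n. ennreal (4 ^ n * D n (fst z) (snd z))) \<noteq> \<infinity>"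
    by (intro nn_integral_PInf_AE) (auto simp: split_beta')
  then show ?thesis
  proof (rule AE_mp, intro AE_I2 impI)
    fix z assume z: "z \<in> space (M \<Otimes>\<^sub>M N)"
      and fin: "(\<Sum>n. ennreal (4 ^ n * D n (fst z) (snd z))) \<noteq> \<infinity>"
    obtain x y where xy: "z = (x, y)" "x \<in> space M" "y \<in> space N"
      using z by (auto simp: space_pair_measure)
    obtain B where B: "0 \<le> B" "(\<Sum>n. ennreal (4 ^ n * D n x y)) = ennreal B"
      using fin xy by (cases "\<Sum>n. ennreal (4 ^ n * D n x y)") auto
    have D_B: "4 ^ n * D n x y \<le> B" for n
    proof -
      have "ennreal (4 ^ n * D n x y) \<le> (\<Sum>n. ennreal (4 ^ n * D n x y))"
        using sum_le_suminf[of "\<lambda>n. ennreal (4 ^ n * D n x y)" "{n}"] by simp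
      then show ?thesis using B by simp
    qed
    obtain F G where F: "\<And>n. f n x \<le> F" and G: "\<And>n. g n y \<le> G"
      using f g xy by metis
    have FG: "0 < F" "0 < G" using F[of 0] G[of 0] pos(1)[of 0 x] pos(2)[of 0 y] by auto
    define r where "r n = f n x * g n y" for n
    \<comment> \<open>The square of an increment is the discrepancy times \<open>q\<close> divided
      by \<open>p x y\<close>; the pointwise bounds give q \<le> (F + F)(G + G), and the discrepancy
      is at most B / 4^n.\<close>
    define L where "L = sqrt (B * (4 * F * G) / p x y)"
    have "\<bar>r (Suc n) - r n\<bar> \<le> L * (1/2) ^ n" for n
    proof -
      define q where "q = (f n x + f (Suc n) x) * (g n y + g (Suc n) y)"
      have q: "0 < q" using pos by (auto simp: q_def intro!: mult_pos_pos add_pos_pos)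
      have "q \<le> (F + F) * (G + G)"
        unfolding q_def using F G FG pos by (intro mult_mono add_mono) (auto simp: add_nonneg_nonneg less_imp_le)
      then have q_le: "q \<le> 4 * F * G" by simp
      have "D n x y = p x y * ((r (Suc n) - r n)\<^sup>2 / q)" by (simp add: D_def discrepancy_def r_def q_def)
      then have "(r (Suc n) - r n)\<^sup>2 = D n x y * q / p x y" using q kernel_pos[of x y] by (simp add: field_simps)
      also have "\<dots> \<le> (B / 4 ^ n) * (4 * F * G) / p x y"
        using D_B[of n] D_nonneg[of n x y] B(1) q q_le kernel_pos[of x y]
        by (intro divide_right_mono mult_mono) (auto simp: field_simps less_imp_le)
      also have "\<dots> = (L * (1/2) ^ n)\<^sup>2"
      proof -
        have "((1/2) ^ n)\<^sup>2 = ((1/2 :: real)\<^sup>2) ^ n"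
          by (simp only: power_mult[symmetric] mult.commute)
        then have "((1/2) ^ n)\<^sup>2 = 1 / (4 :: real) ^ n"
          by (simp add: power2_eq_square power_one_over)
        moreover have "L\<^sup>2 = B * (4 * F * G) / p x y"
          unfolding L_def using B FG kernel_pos[of x y] by (intro real_sqrt_pow2) (simp add: less_imp_le)
        ultimately show ?thesis by (simp only: power_mult_distrib) (simp only: times_divide_times_eq mult_1_right mult.commute divide_divide_eq_left times_divide_eq_left times_divide_eq_right)
      qed
      finally have "\<bar>r (Suc n) - r n\<bar> \<le> \<bar>L * (1/2) ^ n\<bar>"
        by (simp only: abs_le_square_iff)
      moreover have "0 \<le> L * (1/2) ^ n"
        unfolding L_def using B FG kernel_pos[of x y] by (simp add: less_imp_le)
      ultimately show ?thesis by simp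
    qed
    then have r_diff: "norm (r (Suc n) - r n) \<le> L * (1/2) ^ n" for n by simp
    have "summable (\<lambda>n. L * (1/2) ^ n)" by (intro summable_mult summable_geometric) simp
    then have "summable (\<lambda>n. r (Suc n) - r n)"
      by (rule summable_comparison_test') (rule r_diff)
    then have "convergent r" by (rule convergent_of_summable_diff)
    then show "convergent (\<lambda>n. f n (fst z) * g n (snd z))"
      unfolding r_def[abs_def] xy by simp
  qed
qed

text \<open>On \<open>A j\<close> and \<open>B j\<close> the sequences are bounded uniformly in
  \<open>n\<close>, so dominated convergence applies to the truncated couplings. By tightness the
  mass lost in the truncation is small uniformly in \<open>n\<close>, and it disappears as
  \<open>j\<close> grows.\<close>

lemma limit_mass:
  fixes f :: "nat \<Rightarrow> 'x \<Rightarrow> real" and g :: "nat \<Rightarrow> 'y \<Rightarrow> real"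
  assumes sub: "\<And>n. subcoupling (\<eta> n) (f n) (g n)" and \<eta>: "\<eta> \<longlonglongrightarrow> 0"
    and f: "\<And>x. x \<in> space M \<Longrightarrow> \<exists>C. \<forall>n. f n x \<le> C"
    and g: "\<And>y. y \<in> space N \<Longrightarrow> \<exists>C. \<forall>n. g n y \<le> C"
    and [measurable]: "R \<in> borel_measurable (M \<Otimes>\<^sub>M N)"
    and R: "AE z in M \<Otimes>\<^sub>M N. (\<lambda>n. f n (fst z) * g n (snd z)) \<longlonglongrightarrow> R z"
  shows "1 \<le> (\<integral>\<^sup>+ z. ennreal (p (fst z) (snd z) * R z) \<partial>(M \<Otimes>\<^sub>M N))"
proof -
  have [measurable]: "f n \<in> borel_measurable M" "g n \<in> borel_measurable N"
    and pos: "0 < f n x" "0 < g n y" for n x y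
    using sub by (auto simp: subcoupling_def)
  define A where "A j = {x \<in> space M. \<forall>n. f n x \<le> real j}" for j
  define B where "B j = {y \<in> space N. \<forall>n. g n y \<le> real j}" for j
  have [measurable]: "A j \<in> sets M" "B j \<in> sets N" for j unfolding A_def B_def by measurable
  have A_lim: "(\<lambda>j. M1.prob (space M - A j)) \<longlonglongrightarrow> 0"
    unfolding A_def using f by (intro M1.prob_unbounded_tendsto_0) auto
  have B_lim: "(\<lambda>j. M2.prob (space N - B j)) \<longlonglongrightarrow> 0"
    unfolding B_def using g by (intro M2.prob_unbounded_tendsto_0) auto
  define I where "I = (\<integral>\<^sup>+ z. ennreal (p (fst z) (snd z) * R z) \<partial>(M \<Otimes>\<^sub>M N))"
  have R_nonneg: "AE z in M \<Otimes>\<^sub>M N. 0 \<le> R z"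
    using R by eventually_elim (auto intro!: LIMSEQ_le_const less_imp_le[OF mult_pos_pos] pos)
  have step: "ennreal (1 - M1.prob (space M - A j) - M2.prob (space N - B j)) \<le> I" for j
  proof -
    define h where "h u z = indicator (A j) (fst z) * indicator (B j) (snd z) * (p (fst z) (snd z) * u z)"
      for u :: "'x \<times> 'y \<Rightarrow> real" and z
    define r where "r n z = f n (fst z) * g n (snd z)" for n z
    have [measurable]: "r n \<in> borel_measurable (M \<Otimes>\<^sub>M N)" for n unfolding r_def by measurable
    have h_meas [measurable]: "h u \<in> borel_measurable (M \<Otimes>\<^sub>M N)"
      if [measurable]: "u \<in> borel_measurable (M \<Otimes>\<^sub>M N)" for u
      unfolding h_def by measurable
    have h_bound: "AE z in M \<Otimes>\<^sub>M N. norm (h (r n) z) \<le> S * (real j * real j)" for n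
    proof (intro AE_I2)
      fix z
      have "\<bar>p (fst z) (snd z) * (f n (fst z) * g n (snd z))\<bar> \<le> S * (real j * real j)"
        if "fst z \<in> A j" "snd z \<in> B j"
        using that pos[of n] kernel_pos kernel_le bound_pos unfolding abs_mult
        by (intro mult_mono) (auto simp: A_def B_def less_imp_le)
      then show "norm (h (r n) z) \<le> S * (real j * real j)"
        using bound_pos by (auto simp: h_def r_def split: split_indicator)
    qed
    have h_lim: "AE z in M \<Otimes>\<^sub>M N. (\<lambda>n. h (r n) z) \<longlonglongrightarrow> h R z"
      using R unfolding h_def r_def by eventually_elim (intro tendsto_intros)
    have hm: "h R \<in> borel_measurable (M \<Otimes>\<^sub>M N)" "\<And>n. h (r n) \<in> borel_measurable (M \<Otimes>\<^sub>M N)"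
      and const: "integrable (M \<Otimes>\<^sub>M N) (\<lambda>_. S * (real j * real j))"
      by auto
    note lim = integral_dominated_convergence[OF hm const h_lim h_bound]
      and int = integrable_dominated_convergence[OF hm const h_lim h_bound]
    have le: "1 - \<eta> n \<le> (\<integral>z. h (r n) z \<partial>(M \<Otimes>\<^sub>M N))
        + M1.prob (space M - A j) + M2.prob (space N - B j)" for n
      using integral_coupling_restrict(2)[OF sub[of n], of "A j" "B j"]
      by (simp add: h_def r_def split_beta')
    have "1 - 0 \<le> (\<integral>z. h R z \<partial>(M \<Otimes>\<^sub>M N))
        + M1.prob (space M - A j) + M2.prob (space N - B j)"
      by (rule LIMSEQ_le[OF tendsto_diff[OF tendsto_const \<eta>] tendsto_add[OF tendsto_add[OF lim tendsto_const] tendsto_const]])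
        (use le in blast)
    then have "ennreal (1 - M1.prob (space M - A j) - M2.prob (space N - B j)) \<le> ennreal (\<integral>z. h R z \<partial>(M \<Otimes>\<^sub>M N))"
      by (intro ennreal_leI) simp
    also have "ennreal (\<integral>z. h R z \<partial>(M \<Otimes>\<^sub>M N)) = (\<integral>\<^sup>+ z. ennreal (h R z) \<partial>(M \<Otimes>\<^sub>M N))"
      using int kernel_pos R_nonneg
      by (intro nn_integral_eq_integral[symmetric]) (auto simp: h_def less_imp_le split: split_indicator)
    also have "\<dots> \<le> I"
      unfolding I_def using R_nonneg kernel_pos
      by (intro nn_integral_mono_AE) (auto simp: h_def less_imp_le intro!: ennreal_leI split: split_indicator)
    finally show ?thesis .
  qed
  have "(\<lambda>j. ennreal (1 - M1.prob (space M - A j) - M2.prob (space N - B j))) \<longlonglongrightarrow> ennreal (1 - 0 - 0)"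
    by (intro tendsto_ennrealI tendsto_intros A_lim B_lim)
  from LIMSEQ_le_const2[OF this] step show ?thesis unfolding I_def by auto
qed

text \<open>Fatou at a fixed \<open>x\<close>, which is why the first factor is only a sequence of
  numbers. Its hypotheses are those available after rescaling at a reference point.\<close>

lemma limit_row_le:
  fixes F :: "nat \<Rightarrow> real" and g :: "nat \<Rightarrow> 'y \<Rightarrow> real"
  assumes x: "x \<in> space M"
    and [measurable]: "\<And>n. g n \<in> borel_measurable N" "G \<in> borel_measurable N"
    and pos: "\<And>n. 0 \<le> F n" "\<And>n y. 0 \<le> g n y" "\<And>n. \<exists>C. \<forall>y. g n y \<le> C"
    and row: "\<And>n. F n * (\<integral>y. p x y * g n y \<partial>N) \<le> 1"
    and F: "F \<longlonglongrightarrow> F'" and G: "AE y in N. (\<lambda>n. g n y) \<longlonglongrightarrow> G y"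
  shows "(\<integral>\<^sup>+ y. ennreal (p x y * (F' * G y)) \<partial>N) \<le> 1"
proof -
  have px [measurable]: "(\<lambda>y. p x y) \<in> borel_measurable N" using x by measurable
  have "(\<integral>\<^sup>+ y. ennreal (p x y * (F' * G y)) \<partial>N) = (\<integral>\<^sup>+ y. liminf (\<lambda>n. ennreal (p x y * (F n * g n y))) \<partial>N)"
  proof (rule nn_integral_cong_AE, use G in eventually_elim)
    fix y assume "(\<lambda>n. g n y) \<longlonglongrightarrow> G y"
    then have "(\<lambda>n. ennreal (p x y * (F n * g n y))) \<longlonglongrightarrow> ennreal (p x y * (F' * G y))"
      by (intro tendsto_ennrealI tendsto_intros F)
    then show "ennreal (p x y * (F' * G y)) = liminf (\<lambda>n. ennreal (p x y * (F n * g n y)))"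
      by (simp add: lim_imp_Liminf)
  qed
  also have "\<dots> \<le> liminf (\<lambda>n. \<integral>\<^sup>+ y. ennreal (p x y * (F n * g n y)) \<partial>N)"
    by (intro nn_integral_liminf) measurable
  also have "\<dots> \<le> liminf (\<lambda>n. 1)"
  proof (intro Liminf_mono always_eventually allI)
    fix n
    obtain C where C: "\<And>y. g n y \<le> C" using pos(3) by blast
    have int: "integrable N (\<lambda>y. p x y * g n y)"
      using x pos C by (intro integrable_kernel_mult[where C=C]) auto
    have eq: "p x y * (F n * g n y) = F n * (p x y * g n y)" for y by simp
    have "(\<integral>\<^sup>+ y. ennreal (p x y * (F n * g n y)) \<partial>N) = ennreal (F n * (\<integral>y. p x y * g n y \<partial>N))"
      unfolding eq using int pos kernel_pos
      by (subst nn_integral_eq_integral) (auto simp: less_imp_le)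
    also have "\<dots> \<le> 1" using row[of n] by (simp add: ennreal_le_1)
    finally show "(\<integral>\<^sup>+ y. ennreal (p x y * (F n * g n y)) \<partial>N) \<le> 1" .
  qed
  also have "\<dots> = 1" by (simp add: Liminf_const)
  finally show ?thesis .
qed

text \<open>Only the products \<open>f n x * g n y\<close> are known to converge. Dividing out the
  values at a reference point, where the limit is nonzero, turns their convergence into convergence
  of each factor along almost every point.\<close>

lemma system_solvable:
  "\<exists>f \<in> borel_measurable M. \<exists>g \<in> borel_measurable N. (\<forall>x. 0 \<le> f x) \<and> (\<forall>y. 0 \<le> g y) \<and>
     (AE x in M. (\<integral>\<^sup>+ y. ennreal (p x y * (f x * g y)) \<partial>N) = 1) \<and>
     (AE y in N. (\<integral>\<^sup>+ x. ennreal (p x y * (f x * g y)) \<partial>M) = 1)"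
proof -
  interpret flip: bounded_positive_kernel N M "\<lambda>y x. p x y" S by (rule flip)
  define good where "good n f g \<longleftrightarrow> subcoupling ((1/8) ^ Suc n) f g \<and> (\<exists>C. \<forall>x. f x \<le> C) \<and> (\<exists>C. \<forall>y. g y \<le> C) \<and>
    1/2 \<le> M1.prob {x \<in> space M. 1 \<le> f x} \<and> 1/2 \<le> M1.prob {x \<in> space M. f x < 2} \<and>
    (\<forall>x \<in> space M. f x * (\<integral>y. p x y * g y \<partial>N) \<le> 1) \<and>
    (\<forall>y \<in> space N. g y * (\<integral>x. p x y * f x \<partial>M) \<le> 1)" for n :: nat and f g
  have "\<exists>f g. good n f g" for n
    unfolding good_def by (rule approximate_system) simp
  then obtain f g where "\<And>n. good n (f n) (g n)" by metis
  note fg = this[unfolded good_def]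
  have sub: "subcoupling ((1/8) ^ Suc n) (f n) (g n)" for n using fg by blast
  have bounded: "\<exists>C. \<forall>x. f n x \<le> C" "\<exists>C. \<forall>y. g n y \<le> C" for n using fg by blast+
  have row: "f n x * (\<integral>y. p x y * g n y \<partial>N) \<le> 1" if "x \<in> space M" for n x using fg that by blast
  have col: "g n y * (\<integral>x. p x y * f n x \<partial>M) \<le> 1" if "y \<in> space N" for n y using fg that by blast
  have [measurable]: "f n \<in> borel_measurable M" "g n \<in> borel_measurable N"
    and pos: "0 < f n x" "0 < g n y" for n x y
    using sub by (auto simp: subcoupling_def)
  have g_bdd: "\<And>y. y \<in> space N \<Longrightarrow> \<exists>C. \<forall>n. g n y \<le> C" and f_bdd: "\<And>x. x \<in> space M \<Longrightarrow> \<exists>C. \<forall>n. f n x \<le> C"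
    using normalized_sequence_bounded[OF sub _ bounded _ _ row col] fg
    by (auto simp: power_le_one)
  define r where "r n z = f n (fst z) * g n (snd z)" for n z
  have [measurable]: "r n \<in> borel_measurable (M \<Otimes>\<^sub>M N)" for n unfolding r_def by measurable
  define R where "R z = lim (\<lambda>n. r n z)" for z
  have [measurable]: "R \<in> borel_measurable (M \<Otimes>\<^sub>M N)" unfolding R_def by measurable
  have conv: "AE z in M \<Otimes>\<^sub>M N. (\<lambda>n. r n z) \<longlonglongrightarrow> R z"
    using AE_convergent_of_discrepancy[OF sub f_bdd g_bdd]
    by (simp add: convergent_LIMSEQ_iff R_def r_def)
  have "(\<lambda>n. (1/8 :: real) ^ Suc n) \<longlonglongrightarrow> 0"
    using LIMSEQ_Suc[OF LIMSEQ_power_zero[of "1/8 :: real"]] by simp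
  from limit_mass[OF sub this f_bdd g_bdd] conv
  have mass: "1 \<le> (\<integral>\<^sup>+ z. ennreal (p (fst z) (snd z) * R z) \<partial>(M \<Otimes>\<^sub>M N))"
    unfolding r_def by auto
  \<comment> \<open>Positive mass of the limit guarantees a point where it can serve as a
    denominator.\<close>
  have not0: "\<not> (AE z in M \<Otimes>\<^sub>M N. R z = 0)"
  proof
    assume "AE z in M \<Otimes>\<^sub>M N. R z = 0"
    then have "(\<integral>\<^sup>+ z. ennreal (p (fst z) (snd z) * R z) \<partial>(M \<Otimes>\<^sub>M N)) = (\<integral>\<^sup>+ z. 0 \<partial>(M \<Otimes>\<^sub>M N))"
      by (intro nn_integral_cong_AE) auto
    with mass show False by simp
  qed
  have conv_xy: "AE x in M. AE y in N. (\<lambda>n. r n (x, y)) \<longlonglongrightarrow> R (x, y)"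
    using AE_pair[OF conv] .
  have conv_yx: "AE y in N. AE x in M. (\<lambda>n. r n (x, y)) \<longlonglongrightarrow> R (x, y)"
    using conv_xy by (subst (asm) AE_commute) measurable
  \<comment> \<open>The reference point is found one coordinate at a time: \<open>x0\<close> with
    convergence along almost all of its row, and then \<open>y0\<close> in that row with convergence
    along almost all of its column, always keeping \<open>R (x0, y0)\<close> nonzero.\<close>
  have "\<not> (AE x in M. AE y in N. R (x, y) = 0)"
    using not0 AE_pair_iff[of "\<lambda>x y. R (x, y) = 0"] by simp
  from ex_of_not_AE[OF conv_xy this] obtain x0 where x0: "x0 \<in> space M"
    "AE y in N. (\<lambda>n. r n (x0, y)) \<longlonglongrightarrow> R (x0, y)" "\<not> (AE y in N. R (x0, y) = 0)" by blast
  have "AE y in N. (\<lambda>n. r n (x0, y)) \<longlonglongrightarrow> R (x0, y) \<and> (AE x in M. (\<lambda>n. r n (x, y)) \<longlonglongrightarrow> R (x, y))"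
    using x0(2) conv_yx by eventually_elim auto
  from ex_of_not_AE[OF this x0(3)] obtain y0 where y0: "y0 \<in> space N"
    "(\<lambda>n. r n (x0, y0)) \<longlonglongrightarrow> R (x0, y0)" "AE x in M. (\<lambda>n. r n (x, y0)) \<longlonglongrightarrow> R (x, y0)"
    "R (x0, y0) \<noteq> 0" by blast
  define fs where "fs n x = f n x * g n y0" for n x
  define gs where "gs n y = g n y / g n y0" for n y
  \<comment> \<open>\<open>lim\<close> is unspecified where the sequence diverges; the maximum with
    0 secures nonnegativity everywhere and changes nothing at points of convergence.\<close>
  define F where "F x = max 0 (lim (\<lambda>n. fs n x))" for x
  define G where "G y = max 0 (lim (\<lambda>n. gs n y))" for y
  have [measurable]: "fs n \<in> borel_measurable M" "gs n \<in> borel_measurable N" for n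
    unfolding fs_def gs_def by measurable
  have F_meas [measurable]: "F \<in> borel_measurable M" unfolding F_def by measurable
  have G_meas [measurable]: "G \<in> borel_measurable N" unfolding G_def by measurable
  have fs_pos: "0 \<le> fs n x" and gs_pos: "0 \<le> gs n y" for n x y
    using pos[of n] by (auto simp: fs_def gs_def less_imp_le)
  have F_lim: "AE x in M. (\<lambda>n. fs n x) \<longlonglongrightarrow> F x"
    using y0(3)
  proof eventually_elim
    fix x assume "(\<lambda>n. r n (x, y0)) \<longlonglongrightarrow> R (x, y0)"
    then have *: "(\<lambda>n. fs n x) \<longlonglongrightarrow> R (x, y0)" by (simp add: r_def fs_def)
    with fs_pos have "0 \<le> R (x, y0)" by (auto intro: LIMSEQ_le_const)
    with * show "(\<lambda>n. fs n x) \<longlonglongrightarrow> F x" by (simp add: F_def limI)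
  qed
  have G_lim: "AE y in N. (\<lambda>n. gs n y) \<longlonglongrightarrow> G y"
    using x0(2)
  proof eventually_elim
    fix y assume "(\<lambda>n. r n (x0, y)) \<longlonglongrightarrow> R (x0, y)"
    then have "(\<lambda>n. r n (x0, y) / r n (x0, y0)) \<longlonglongrightarrow> R (x0, y) / R (x0, y0)"
      using y0 by (intro tendsto_divide)
    moreover have "r n (x0, y) / r n (x0, y0) = gs n y" for n
      using pos(1)[of n x0] by (simp add: r_def gs_def)
    ultimately have *: "(\<lambda>n. gs n y) \<longlonglongrightarrow> R (x0, y) / R (x0, y0)" by simp
    with gs_pos have "0 \<le> R (x0, y) / R (x0, y0)" by (auto intro: LIMSEQ_le_const)
    with * show "(\<lambda>n. gs n y) \<longlonglongrightarrow> G y" by (simp add: G_def limI)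
  qed
  have fs_bdd: "\<exists>C. \<forall>x. fs n x \<le> C" for n
  proof -
    obtain C where "\<And>x. f n x \<le> C" using bounded by blast
    then show ?thesis
      using pos(2)[of n y0] by (intro exI[of _ "C * g n y0"]) (auto simp: fs_def intro!: mult_right_mono)
  qed
  have gs_bdd: "\<exists>C. \<forall>y. gs n y \<le> C" for n
  proof -
    obtain C where "\<And>y. g n y \<le> C" using bounded by blast
    then show ?thesis
      using pos(2)[of n y0] by (intro exI[of _ "C / g n y0"]) (auto simp: gs_def intro!: divide_right_mono)
  qed
  have row_le: "AE x in M. (\<integral>\<^sup>+ y. ennreal (p x y * (F x * G y)) \<partial>N) \<le> 1"
    using F_lim AE_space
  proof eventually_elim
    fix x assume x: "(\<lambda>n. fs n x) \<longlonglongrightarrow> F x" "x \<in> space M"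
    show "(\<integral>\<^sup>+ y. ennreal (p x y * (F x * G y)) \<partial>N) \<le> 1"
    proof (rule limit_row_le[OF x(2) _ _ fs_pos gs_pos gs_bdd _ x(1) G_lim])
      show "fs n x * (\<integral>y. p x y * gs n y \<partial>N) \<le> 1" for n
        using row[OF x(2), of n] pos(2)[of n y0] by (simp add: fs_def gs_def)
    qed measurable
  qed
  have col_le: "AE y in N. (\<integral>\<^sup>+ x. ennreal (p x y * (G y * F x)) \<partial>M) \<le> 1"
    using G_lim AE_space
  proof eventually_elim
    fix y assume y: "(\<lambda>n. gs n y) \<longlonglongrightarrow> G y" "y \<in> space N"
    show "(\<integral>\<^sup>+ x. ennreal (p x y * (G y * F x)) \<partial>M) \<le> 1"
    proof (rule flip.limit_row_le[OF y(2) _ _ gs_pos fs_pos fs_bdd _ y(1) F_lim])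
      fix n
      have "(\<integral>x. p x y * fs n x \<partial>M) = (\<integral>x. p x y * f n x \<partial>M) * g n y0"
        by (simp add: fs_def mult.assoc[symmetric])
      then show "gs n y * (\<integral>x. p x y * fs n x \<partial>M) \<le> 1"
        using col[OF y(2), of n] pos(2)[of n y0] by (simp add: gs_def)
    qed measurable
  qed
  have "(\<integral>\<^sup>+ z. ennreal (p (fst z) (snd z) * R z) \<partial>(M \<Otimes>\<^sub>M N)) =
      (\<integral>\<^sup>+ x. \<integral>\<^sup>+ y. ennreal (p x y * R (x, y)) \<partial>N \<partial>M)"
    by (subst M2.nn_integral_fst[symmetric]) auto
  also have "\<dots> = (\<integral>\<^sup>+ x. \<integral>\<^sup>+ y. ennreal (p x y * (F x * G y)) \<partial>N \<partial>M)"
  proof (rule nn_integral_cong_AE, use conv_xy F_lim in eventually_elim)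
    fix x assume x: "AE y in N. (\<lambda>n. r n (x, y)) \<longlonglongrightarrow> R (x, y)" "(\<lambda>n. fs n x) \<longlonglongrightarrow> F x"
    show "(\<integral>\<^sup>+ y. ennreal (p x y * R (x, y)) \<partial>N) = (\<integral>\<^sup>+ y. ennreal (p x y * (F x * G y)) \<partial>N)"
    proof (rule nn_integral_cong_AE, use x(1) G_lim in eventually_elim)
      fix y assume y: "(\<lambda>n. r n (x, y)) \<longlonglongrightarrow> R (x, y)" "(\<lambda>n. gs n y) \<longlonglongrightarrow> G y"
      have "r n (x, y) = fs n x * gs n y" for n
        using pos(2)[of n y0] by (simp add: r_def fs_def gs_def)
      then have "R (x, y) = F x * G y"
        using LIMSEQ_unique[OF y(1)] tendsto_mult[OF x(2) y(2)] by simp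
      then show "ennreal (p x y * R (x, y)) = ennreal (p x y * (F x * G y))" by simp
    qed
  qed
  finally have mass_x: "1 \<le> (\<integral>\<^sup>+ x. \<integral>\<^sup>+ y. ennreal (p x y * (F x * G y)) \<partial>N \<partial>M)" using mass by simp
  have "(\<integral>\<^sup>+ y. \<integral>\<^sup>+ x. ennreal (p x y * (F x * G y)) \<partial>M \<partial>N) = (\<integral>\<^sup>+ x. \<integral>\<^sup>+ y. ennreal (p x y * (F x * G y)) \<partial>N \<partial>M)"
    by (rule Fubini') measurable
  with mass_x have mass_y: "1 \<le> (\<integral>\<^sup>+ y. \<integral>\<^sup>+ x. ennreal (p x y * (F x * G y)) \<partial>M \<partial>N)" by simp
  have "AE x in M. (\<integral>\<^sup>+ y. ennreal (p x y * (F x * G y)) \<partial>N) = 1"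
    by (rule M1.AE_eq_1_of_nn_integral[OF _ row_le mass_x]) measurable
  moreover have "AE y in N. (\<integral>\<^sup>+ x. ennreal (p x y * (F x * G y)) \<partial>M) = 1"
    by (rule M2.AE_eq_1_of_nn_integral[OF _ _ mass_y]) (use col_le in \<open>simp_all add: mult.commute\<close>)
  moreover have "0 \<le> F x" "0 \<le> G y" for x y by (auto simp: F_def G_def)
  ultimately show ?thesis by (intro bexI[OF _ F_meas] bexI[OF _ G_meas]) auto
qed

subsection \<open>Solutions as measures\<close>

lemma borel_measurable_nn_integral_kernel:
  assumes b: "sigma_finite_measure b" and [measurable_cong]: "sets b = sets N"
  shows "(\<lambda>x. \<integral>\<^sup>+ y. ennreal (p x y) \<partial>b) \<in> borel_measurable M"
proof -
  interpret b: sigma_finite_measure b by fact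
  show ?thesis by measurable
qed

text \<open>Translates the first equation of the system, for measures given by densities, into a
  condition on the row integrals of the coupling; the flipped version does the same for the
  second.\<close>

lemma density_nn_integral_kernel:
  assumes [measurable]: "f \<in> borel_measurable M" "g \<in> borel_measurable N"
    and pos: "\<And>x. 0 \<le> f x" "\<And>y. 0 \<le> g y"
  shows "density (density M (\<lambda>x. ennreal (f x))) (\<lambda>x. \<integral>\<^sup>+ y. ennreal (p x y) \<partial>density N (\<lambda>y. ennreal (g y)))
    = density M (\<lambda>x. \<integral>\<^sup>+ y. ennreal (p x y * (f x * g y)) \<partial>N)"
proof -
  have sf: "sigma_finite_measure (density N (\<lambda>y. ennreal (g y)))"
    by (simp add: M2.sigma_finite_iff_density_finite)
  have [measurable]: "(\<lambda>x. \<integral>\<^sup>+ y. ennreal (p x y) \<partial>density N (\<lambda>y. ennreal (g y))) \<in> borel_measurable M"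
    by (rule borel_measurable_nn_integral_kernel[OF sf]) simp
  show ?thesis
  proof (subst density_density_eq, measurable, rule density_cong)
    show "AE x in M. ennreal (f x) * (\<integral>\<^sup>+ y. ennreal (p x y) \<partial>density N (\<lambda>y. ennreal (g y))) =
        (\<integral>\<^sup>+ y. ennreal (p x y * (f x * g y)) \<partial>N)"
    proof (rule AE_I2)
      fix x assume x: "x \<in> space M"
      then have [measurable]: "(\<lambda>y. p x y) \<in> borel_measurable N" by measurable
      show "ennreal (f x) * (\<integral>\<^sup>+ y. ennreal (p x y) \<partial>density N (\<lambda>y. ennreal (g y))) =
        (\<integral>\<^sup>+ y. ennreal (p x y * (f x * g y)) \<partial>N)"
        using pos kernel_pos
        by (subst nn_integral_density)
          (auto simp: less_imp_le ennreal_mult mult_ac simp flip: nn_integral_cmult)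
    qed
  qed measurable
qed

lemma schroedinger_solution_exists: "\<exists>a b. schroedinger_solution M N p a b"
proof -
  interpret flip: bounded_positive_kernel N M "\<lambda>y x. p x y" S by (rule flip)
  obtain f g where [measurable]: "f \<in> borel_measurable M" "g \<in> borel_measurable N"
    and pos: "\<And>x. 0 \<le> f x" "\<And>y. 0 \<le> g y"
    and row: "AE x in M. (\<integral>\<^sup>+ y. ennreal (p x y * (f x * g y)) \<partial>N) = 1"
    and col: "AE y in N. (\<integral>\<^sup>+ x. ennreal (p x y * (f x * g y)) \<partial>M) = 1"
    using system_solvable by blast
  define a where "a = density M (\<lambda>x. ennreal (f x))"
  define b where "b = density N (\<lambda>y. ennreal (g y))"
  have "density a (\<lambda>x. \<integral>\<^sup>+ y. ennreal (p x y) \<partial>b) = density M (\<lambda>_. 1)"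
    unfolding a_def b_def using pos row
    by (subst density_nn_integral_kernel) (auto intro!: density_cong)
  moreover have "density b (\<lambda>y. \<integral>\<^sup>+ x. ennreal (p x y) \<partial>a) = density N (\<lambda>_. 1)"
    unfolding a_def b_def using pos col
    by (subst flip.density_nn_integral_kernel) (auto intro!: density_cong simp: mult.commute[of "g _"])
  moreover have "sigma_finite_measure a" "sigma_finite_measure b"
    unfolding a_def b_def by (auto simp: M1.sigma_finite_iff_density_finite M2.sigma_finite_iff_density_finite)
  ultimately have "schroedinger_solution M N p a b"
    by (simp add: schroedinger_solution_def density_1) (simp add: a_def b_def)
  then show ?thesis by blast
qed

section \<open>Reduction of arbitrary solutions to densities, and uniqueness\<close>

text \<open>The first equation reads M = h a with h the integral of the kernel against
  \<open>b\<close>, so a is M divided by h once h is positive and almost everywhere finite. A zero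
  of h would make \<open>b\<close> the null measure, as p is positive, and then the second equation
  would make \<open>N\<close> null. Finiteness follows because the integral of h against
  \<open>a\<close> is the mass of \<open>M\<close>.\<close>

lemma schroedinger_solution_density:
  assumes sol: "schroedinger_solution M N p a b"
  shows "\<exists>f \<in> borel_measurable M. (\<forall>x. 0 < f x) \<and> a = density M (\<lambda>x. ennreal (f x))"
proof -
  interpret flip: bounded_positive_kernel N M "\<lambda>y x. p x y" S by (rule flip)
  have sf: "sigma_finite_measure b" "sigma_finite_measure a" and sets: "sets b = sets N" "sets a = sets M"
    and eq: "density a (\<lambda>x. \<integral>\<^sup>+ y. ennreal (p x y) \<partial>b) = M"
      "density b (\<lambda>y. \<integral>\<^sup>+ x. ennreal (p x y) \<partial>a) = N"
    using sol by (auto simp: schroedinger_solution_def)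
  define h where "h x = (\<integral>\<^sup>+ y. ennreal (p x y) \<partial>b)" for x
  have h_M: "h \<in> borel_measurable M"
    unfolding h_def by (rule borel_measurable_nn_integral_kernel[OF sf(1) sets(1)])
  then have [measurable]: "h \<in> borel_measurable a" by (simp cong: measurable_cong_sets add: sets)
  have M_eq: "M = density a h" using eq(1) by (simp add: h_def[abs_def])
  have h_pos: "0 < h x" if x: "x \<in> space M" for x
  proof (rule ccontr)
    assume "\<not> 0 < h x"
    then have "h x = 0" by (simp add: zero_less_iff_neq_zero)
    moreover have "(\<lambda>y. ennreal (p x y)) \<in> borel_measurable b"
    proof -
      have "(\<lambda>y. ennreal (p x y)) \<in> borel_measurable N" using x by measurable
      then show ?thesis by (simp cong: measurable_cong_sets add: sets)
    qed
    ultimately have "AE y in b. ennreal (p x y) = 0" by (simp add: h_def nn_integral_0_iff_AE)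
    then have "AE y in b. False" using kernel_pos by (auto simp: ennreal_eq_0_iff not_le[symmetric])
    moreover have "(\<lambda>y. \<integral>\<^sup>+ x. ennreal (p x y) \<partial>a) \<in> borel_measurable b"
      using flip.borel_measurable_nn_integral_kernel[OF sf(2) sets(2)]
      by (simp cong: measurable_cong_sets add: sets)
    ultimately have "AE y in N. False"
      by (subst eq(2)[symmetric]) (auto simp: AE_density elim: eventually_mono)
    then show False by (simp add: M2.AE_False)
  qed
  have "(\<integral>\<^sup>+ x. h x \<partial>a) = emeasure M (space M)"
    by (subst (1 2) M_eq) (simp add: emeasure_density cong: nn_integral_cong)
  then have "AE x in a. h x \<noteq> \<infinity>"
    by (intro nn_integral_PInf_AE) (auto simp: M1.emeasure_space_1)
  then have h_fin: "AE x in a. h x * (1 / h x) = 1"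
  proof (rule AE_mp, intro AE_I2 impI)
    fix x assume "x \<in> space a" "h x \<noteq> \<infinity>"
    then show "h x * (1 / h x) = 1"
      using h_pos[of x] sets_eq_imp_space_eq[OF sets(2)]
      by (simp add: ennreal_times_divide ennreal_divide_self top.not_eq_extremum)
  qed
  have "density M (\<lambda>x. 1 / h x) = density a (\<lambda>x. h x * (1 / h x))"
    by (subst M_eq, subst density_density_eq) auto
  also have "\<dots> = density a (\<lambda>_. 1)"
    using h_fin by (intro density_cong) auto
  finally have a_eq: "a = density M (\<lambda>x. 1 / h x)" by (simp add: density_1)
  (* the value 1 is taken on a null set only; it makes f positive everywhere *)
  define f where "f x = (if 0 < enn2real (1 / h x) then enn2real (1 / h x) else 1)" for x
  have f_M: "f \<in> borel_measurable M" unfolding f_def using h_M by measurable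
  have "AE x in M. h x \<noteq> \<infinity>"
    using \<open>AE x in a. h x \<noteq> \<infinity>\<close> by (subst M_eq) (auto simp: AE_density)
  then have "AE x in M. 1 / h x = ennreal (f x)"
  proof (rule AE_mp, intro AE_I2 impI)
    fix x assume "x \<in> space M" "h x \<noteq> \<infinity>"
    with h_pos have "0 < h x" "h x < \<infinity>" by (auto simp: top.not_eq_extremum)
    then obtain c where "h x = ennreal c" "0 < c" by (cases "h x") auto
    then have "1 / h x = ennreal (1 / c)"
      using divide_ennreal[of 1 c] by simp
    with \<open>0 < c\<close> show "1 / h x = ennreal (f x)" by (simp add: f_def)
  qed
  with a_eq h_M f_M have "a = density M (\<lambda>x. ennreal (f x))"
    by (subst a_eq, intro density_cong) auto
  with f_M show ?thesis by (intro bexI[of _ f]) (auto simp: f_def)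
qed

text \<open>Brings every solution into the scope of \<open>discrepancy_le\<close>: the row equation
  gives the coupling total mass 1, so it is integrable, and the extended integrals become real
  ones.\<close>

lemma schroedinger_solution_subcoupling:
  assumes sol: "schroedinger_solution M N p a b"
  shows "\<exists>f g. subcoupling 0 f g \<and> a = density M (\<lambda>x. ennreal (f x)) \<and> b = density N (\<lambda>y. ennreal (g y))"
proof -
  interpret flip: bounded_positive_kernel N M "\<lambda>y x. p x y" S by (rule flip)
  obtain f where [measurable]: "f \<in> borel_measurable M" and f: "\<And>x. 0 < f x" "a = density M (\<lambda>x. ennreal (f x))"
    using schroedinger_solution_density[OF sol] by blast
  have "schroedinger_solution N M (\<lambda>y x. p x y) b a"
    using sol by (auto simp: schroedinger_solution_def)
  from flip.schroedinger_solution_density[OF this]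
  obtain g where [measurable]: "g \<in> borel_measurable N" and g: "\<And>y. 0 < g y" "b = density N (\<lambda>y. ennreal (g y))"
    by blast
  have "density M (\<lambda>x. \<integral>\<^sup>+ y. ennreal (p x y * (f x * g y)) \<partial>N) = density M (\<lambda>_. 1)"
    using sol density_nn_integral_kernel[of f g] f g
    by (simp add: schroedinger_solution_def less_imp_le density_1)
  then have row: "AE x in M. (\<integral>\<^sup>+ y. ennreal (p x y * (f x * g y)) \<partial>N) = 1"
    by (subst (asm) M1.density_unique_iff) auto
  have "density N (\<lambda>y. \<integral>\<^sup>+ x. ennreal (p x y * (g y * f x)) \<partial>M) = density N (\<lambda>_. 1)"
    using sol flip.density_nn_integral_kernel[of g f] f g
    by (simp add: schroedinger_solution_def less_imp_le density_1)
  then have col: "AE y in N. (\<integral>\<^sup>+ x. ennreal (p x y * (g y * f x)) \<partial>M) = 1"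
    by (subst (asm) M2.density_unique_iff) auto
  have "(\<integral>\<^sup>+ z. ennreal (p (fst z) (snd z) * (f (fst z) * g (snd z))) \<partial>(M \<Otimes>\<^sub>M N)) =
      (\<integral>\<^sup>+ x. \<integral>\<^sup>+ y. ennreal (p x y * (f x * g y)) \<partial>N \<partial>M)"
    by (subst M2.nn_integral_fst[symmetric]) auto
  also have "\<dots> = (\<integral>\<^sup>+ x. 1 \<partial>M)" by (rule nn_integral_cong_AE) (rule row)
  also have "\<dots> = 1" by (simp add: M1.emeasure_space_1)
  finally have total: "(\<integral>\<^sup>+ z. ennreal (p (fst z) (snd z) * (f (fst z) * g (snd z))) \<partial>(M \<Otimes>\<^sub>M N)) = 1" .
  have nonneg: "0 \<le> p x y * (f x * g y)" "0 \<le> p x y * (g y * f x)" for x y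
    using f g kernel_pos by (auto simp: less_imp_le)
  have "integrable (M \<Otimes>\<^sub>M N) (\<lambda>(x, y). p x y * (f x * g y))"
    using total nonneg by (intro integrableI_nonneg) (auto simp: split_beta')
  moreover have "(\<integral>(x, y). p x y * (f x * g y) \<partial>(M \<Otimes>\<^sub>M N)) = 1"
    using total nonneg by (subst integral_eq_nn_integral) (auto simp: split_beta')
  moreover have "AE x in M. f x * (\<integral>y. p x y * g y \<partial>N) \<le> 1"
    using row AE_space
  proof eventually_elim
    fix x assume x: "(\<integral>\<^sup>+ y. ennreal (p x y * (f x * g y)) \<partial>N) = 1" "x \<in> space M"
    then have "(\<integral>y. p x y * (f x * g y) \<partial>N) = 1"
      using nonneg by (subst integral_eq_nn_integral) auto
    then show "f x * (\<integral>y. p x y * g y \<partial>N) \<le> 1" by (simp add: mult.left_commute)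
  qed
  moreover have "AE y in N. g y * (\<integral>x. p x y * f x \<partial>M) \<le> 1"
    using col AE_space
  proof eventually_elim
    fix y assume y: "(\<integral>\<^sup>+ x. ennreal (p x y * (g y * f x)) \<partial>M) = 1" "y \<in> space N"
    then have "(\<integral>x. p x y * (g y * f x) \<partial>M) = 1"
      using nonneg by (subst integral_eq_nn_integral) auto
    then show "g y * (\<integral>x. p x y * f x \<partial>M) \<le> 1" by (simp add: mult.left_commute)
  qed
  ultimately have "subcoupling 0 f g" using f g by (auto simp: subcoupling_def)
  with f g show ?thesis by blast
qed

text \<open>With zero defects the discrepancy vanishes almost everywhere, so f'g' = fg. Separation
  of variables finishes: a generic \<open>x0\<close> determines g' as a multiple of g, and for
  almost every \<open>x\<close> a generic \<open>y\<close> gives the reciprocal multiple for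
  f'.\<close>

lemma schroedinger_solution_unique:
  assumes "schroedinger_solution M N p a b" "schroedinger_solution M N p a' b'"
  shows "\<exists>\<kappa>>0. a' = scale_measure (ennreal (inverse \<kappa>)) a \<and> b' = scale_measure (ennreal \<kappa>) b"
proof -
  obtain f g where sub: "subcoupling 0 f g"
    and ab: "a = density M (\<lambda>x. ennreal (f x))" "b = density N (\<lambda>y. ennreal (g y))"
    using schroedinger_solution_subcoupling[OF assms(1)] by blast
  obtain f' g' where sub': "subcoupling 0 f' g'"
    and ab': "a' = density M (\<lambda>x. ennreal (f' x))" "b' = density N (\<lambda>y. ennreal (g' y))"
    using schroedinger_solution_subcoupling[OF assms(2)] by blast
  have [measurable]: "f \<in> borel_measurable M" "f' \<in> borel_measurable M"
    "g \<in> borel_measurable N" "g' \<in> borel_measurable N"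
    and pos: "\<And>x. 0 < f x" "\<And>x. 0 < f' x" "\<And>y. 0 < g y" "\<And>y. 0 < g' y"
    using sub sub' by (auto simp: subcoupling_def)
  note D = discrepancy_le[OF sub sub']
  have nonneg: "0 \<le> discrepancy f g f' g' x y" for x y using pos by (intro discrepancy_nonneg)
  have "(\<integral>(x, y). discrepancy f g f' g' x y \<partial>(M \<Otimes>\<^sub>M N)) = 0"
    using D(2) nonneg by (intro antisym integral_nonneg_AE) auto
  then have "AE (x, y) in M \<Otimes>\<^sub>M N. discrepancy f g f' g' x y = 0"
    using integral_nonneg_eq_0_iff_AE[OF D(1)] nonneg by (simp add: split_beta')
  then have "AE x in M. AE y in N. discrepancy f g f' g' x y = 0"
    by (auto dest: AE_pair)
  then have eq: "AE x in M. AE y in N. f' x * g' y = f x * g y"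
  proof eventually_elim
    fix x assume "AE y in N. discrepancy f g f' g' x y = 0"
    then show "AE y in N. f' x * g' y = f x * g y"
    proof eventually_elim
      fix y assume "discrepancy f g f' g' x y = 0"
      then show "f' x * g' y = f x * g y"
        using kernel_pos[of x y] add_pos_pos[OF pos(1)[of x] pos(2)[of x]] add_pos_pos[OF pos(3)[of y] pos(4)[of y]]
        by (auto simp: discrepancy_def)
    qed
  qed
  then obtain x0 where x0: "AE y in N. f' x0 * g' y = f x0 * g y"
    using ex_of_not_AE[OF eq, of "\<lambda>_. False"] by (auto simp: M1.AE_False)
  define \<kappa> where "\<kappa> = f x0 / f' x0"
  have \<kappa>: "0 < \<kappa>" using pos by (simp add: \<kappa>_def)
  have g': "AE y in N. g' y = \<kappa> * g y"
    using x0
  proof eventually_elim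
    fix y assume "f' x0 * g' y = f x0 * g y"
    then show "g' y = \<kappa> * g y" using pos(2)[of x0] by (simp add: \<kappa>_def field_simps)
  qed
  have f': "AE x in M. f' x = inverse \<kappa> * f x"
    using eq
  proof eventually_elim
    fix x assume "AE y in N. f' x * g' y = f x * g y"
    with g' have "AE y in N. f' x * (\<kappa> * g y) = f x * g y" by eventually_elim simp
    then obtain y where "f' x * (\<kappa> * g y) = f x * g y"
      using ex_of_not_AE[where L=N and Q="\<lambda>_. False"] by (auto simp: M2.AE_False)
    then show "f' x = inverse \<kappa> * f x" using pos(3)[of y] \<kappa> by (simp add: field_simps)
  qed
  have "a' = density M (\<lambda>x. ennreal (inverse \<kappa>) * ennreal (f x))"
    unfolding ab' using f' pos \<kappa> by (intro density_cong) (auto simp: ennreal_mult[symmetric] less_imp_le)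
  moreover have "b' = density N (\<lambda>y. ennreal \<kappa> * ennreal (g y))"
    unfolding ab' using g' pos \<kappa> by (intro density_cong) (auto simp: ennreal_mult[symmetric] less_imp_le)
  ultimately show ?thesis
    using \<kappa> by (intro exI[of _ \<kappa>]) (simp add: density_cmult_eq_scale_measure ab)
qed

end

text \<open>Allows the kernel to be altered off the spaces. If the measures have the wrong
  measurable sets, both sides are false.\<close>

lemma schroedinger_solution_cong:
  assumes "\<And>x y. x \<in> space \<mu> \<Longrightarrow> y \<in> space \<nu> \<Longrightarrow> p x y = q x y"
  shows "schroedinger_solution \<mu> \<nu> p a b \<longleftrightarrow> schroedinger_solution \<mu> \<nu> q a b"
proof (cases "sets a = sets \<mu> \<and> sets b = sets \<nu>")
  case True
  then have sp: "space a = space \<mu>" "space b = space \<nu>" by (auto dest: sets_eq_imp_space_eq)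
  have "density a (\<lambda>x. \<integral>\<^sup>+ y. ennreal (p x y) \<partial>b) = density a (\<lambda>x. \<integral>\<^sup>+ y. ennreal (q x y) \<partial>b)"
    by (intro density_cong_space nn_integral_cong) (simp add: assms sp)
  moreover have "density b (\<lambda>y. \<integral>\<^sup>+ x. ennreal (p x y) \<partial>a) = density b (\<lambda>y. \<integral>\<^sup>+ x. ennreal (q x y) \<partial>a)"
    by (intro density_cong_space nn_integral_cong) (simp add: assms sp)
  ultimately show ?thesis by (simp add: schroedinger_solution_def)
qed (auto simp: schroedinger_solution_def)

theorem theorem1p9:
  fixes \<mu> :: "'x::topological_space measure"
    and \<nu> :: "'y measure"
    and p :: "'x \<Rightarrow> 'y \<Rightarrow> real"
    and K :: "'x set"
    and J :: nat
    and xs :: "nat \<Rightarrow> 'x"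
    and c :: "nat \<Rightarrow> real"
  assumes "prob_space \<mu>" and "sets \<mu> = sets borel"
    and "prob_space \<nu>"
    and "(\<lambda>(x, y). p x y) \<in> borel_measurable (borel \<Otimes>\<^sub>M \<nu>)"
    and "\<And>x y. y \<in> space \<nu> \<Longrightarrow> p x y > 0"
    and "bdd_above ((\<lambda>(x, y). p x y) ` (UNIV \<times> space \<nu>))"
    and "K \<noteq> {}" and "compact K"
    and "\<And>y. y \<in> space \<nu> \<Longrightarrow> continuous_on K (\<lambda>x. p x y)"
    and "\<And>j. j \<in> {1..J} \<Longrightarrow> c j > 0"
    and "\<And>y. y \<in> space \<nu> \<Longrightarrow> (SUP x\<in>K. p x y) \<le> (\<Sum>j=1..J. c j * p (xs j) y)"
  shows "(\<exists>a b. schroedinger_solution \<mu> \<nu> p a b) \<and>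
         (\<forall>a b a' b'. schroedinger_solution \<mu> \<nu> p a b \<longrightarrow> schroedinger_solution \<mu> \<nu> p a' b' \<longrightarrow>
            (\<exists>\<kappa>::real. \<kappa> > 0 \<and>
               a' = scale_measure (ennreal (inverse \<kappa>)) a \<and> b' = scale_measure (ennreal \<kappa>) b))"
proof -
  \<comment> \<open>The locale asks for positivity and a bound at every point.
    \<open>space \<mu>\<close> is the whole type, so only \<open>y\<close> has to be treated; the
    value 1 off \<open>space \<nu>\<close> accounts for the bound \<open>max C 1\<close>.\<close>
  define q where "q x y = (if y \<in> space \<nu> then p x y else 1)" for x y
  interpret \<mu>: prob_space \<mu> by fact
  interpret \<nu>: prob_space \<nu> by fact
  interpret pair_prob_space \<mu> \<nu> ..
  obtain C where C: "\<And>x y. y \<in> space \<nu> \<Longrightarrow> p x y \<le> C"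
    using assms(6) by (auto simp: bdd_above_def)
  have "(\<lambda>(x, y). p x y) \<in> borel_measurable (\<mu> \<Otimes>\<^sub>M \<nu>)"
    using assms(4) by (simp cong: measurable_cong_sets add: sets_pair_measure_cong[OF assms(2) refl])
  then have "(\<lambda>(x, y). q x y) \<in> borel_measurable (\<mu> \<Otimes>\<^sub>M \<nu>)"
    by (rule measurable_cong[THEN iffD1, rotated]) (auto simp: q_def space_pair_measure)
  then interpret bounded_positive_kernel \<mu> \<nu> q "max C 1"
    using assms(5) C by unfold_locales (auto simp: q_def le_max_iff_disj)
  have "schroedinger_solution \<mu> \<nu> p = schroedinger_solution \<mu> \<nu> q"
    by (intro ext schroedinger_solution_cong) (simp add: q_def)
  then show ?thesis
    using schroedinger_solution_exists schroedinger_solution_unique by auto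
qed

end
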